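(* Let $d\in\mathbb{N}$, $n\in\mathbb{N}$ with $n\ge 1$, $0<\beta<1$ and $0<\alpha<2$. Let $B^{\beta,\alpha}=\{B^{\beta,\alpha}(t),\,t\ge 0\}$ be the $d$-dimensional generalized grey Brownian motion, and let $$S^{\beta,\alpha}(k):=\frac{1}{n^{2}}\int_{0}^{n}dt\int_{0}^{n}ds\,\mathbb{E}\left(e^{i(k,B^{\beta,\alpha}(t)-B^{\beta,\alpha}(s))}\right),\quad k\in\mathbb{R}^{d},$$ be its form factor. Then for every $k\in\mathbb{R}^{d}$ $$S^{\beta,\alpha}(k)=2\,{}_{2}\Psi_{2}\left(\begin{array}{cc}(1,\alpha), & (1,1)\\ (1,\beta), & (3,\alpha)\end{array}\bigg|-\frac{n^{\alpha}|k|^{2}}{2}\right)=2\sum_{j=0}^{\infty}\frac{1}{\Gamma(\beta j+1)(\alpha j+1)(\alpha j+2)}\left(-\frac{n^{\alpha}|k|^{2}}{2}\right)^{j}.$$ In particular, for fixed $\beta,\alpha$ the form factor depends only on $y^{2}=\frac{n^{\alpha}|k|^{2}}{2}$: one has $S^{\beta,\alpha}(k)=f_{D}(y;\beta,\alpha)$ with the Debye function $$f_{D}(y;\beta,\alpha)=2\sum_{j=0}^{\infty}\frac{(-y^{2})^{j}}{\Gamma(\beta j+1)(\alpha j+1)(\alpha j+2)}.$$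
   Context: Fox-Wright function: ${}_{2}\Psi_{2}\left(\begin{array}{cc}(a_{1},b_{1}), & (a_{2},b_{2})\\ (c_{1},d_{1}), & (c_{2},d_{2})\end{array}\big|x\right)=\sum_{j=0}^{\infty}\frac{\Gamma(a_{1}+b_{1}j)\Gamma(a_{2}+b_{2}j)}{\Gamma(c_{1}+d_{1}j)\Gamma(c_{2}+d_{2}j)}\frac{x^{j}}{j!}$. Mittag-Leffler function: $E_{\beta}(z)=\sum_{j=0}^{\infty}\frac{z^{j}}{\Gamma(\beta j+1)}$, $z\in\mathbb{C}$, $\beta>0$. Mittag-Leffler measure: let $S_{d}=S(\mathbb{R})\otimes\mathbb{R}^{d}$ (Schwartz functions $\varphi=(\varphi_{1},\dots,\varphi_{d})$) with dual $S_{d}'=S'(\mathbb{R})\otimes\mathbb{R}^{d}$ (elements $w=(w_1,\dots,w_d)$), dual pairing $\langle w,\varphi\rangle_{0}=\sum_{j=1}^{d}\langle w_{j},\varphi_{j}\rangle$ extending the $L^2$ inner product, and norm $|\varphi|_{0}^{2}=\sum_{j=1}^{d}|\varphi_{j}|_{L^{2}(\mathbb{R})}^{2}$. For $\beta\in(0,1]$, $\mu_{\beta}$ is the unique probability measure on $S_{d}'$ (with the $\sigma$-algebra generated by cylinder sets) such that $\int_{S_{d}'}e^{i\langle w,\varphi\rangle_{0}}\,d\mu_{\beta}(w)=E_{\beta}\left(-\frac{1}{2}|\varphi|_{0}^{2}\right)$ for all $\varphi\in S_{d}$. Expectation $\mathbb{E}$ is with respect to $\mu_{\beta}$. Since $\int\langle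 w,\varphi\rangle_{0}^{2}\,d\mu_{\beta}(w)=\frac{1}{\Gamma(\beta+1)}|\varphi|_{0}^{2}$, the map $\varphi\mapsto\langle\cdot,\varphi\rangle_{0}\in L^{2}(\mu_{\beta})$ extends by continuity to all $\varphi\in L^{2}(\mathbb{R})\otimes\mathbb{R}^{d}$. Generalized grey Brownian motion: for $0<\alpha<2$ and $t\ge 0$, let $M_{-}^{\alpha/2}1_{[0,t)}\in L^{2}(\mathbb{R})$ be the function $x\mapsto\frac{K_{\alpha/2}}{\Gamma((\alpha+1)/2)}\left((t-x)_{+}^{(\alpha-1)/2}-(-x)_{+}^{(\alpha-1)/2}\right)$, with $K_{\alpha/2}=\sqrt{\alpha\sin(\alpha\pi/2)\Gamma(\alpha)}$ (equal to $1_{[0,t)}$ a.e. if $\alpha=1$; here $u_+^{p}=u^{p}$ for $u>0$ and $0$ for $u\le0$). It is a known fact that $\left(M_{-}^{\alpha/2}1_{[0,t)},M_{-}^{\alpha/2}1_{[0,s)}\right)_{L^{2}}=\frac{1}{2}\left(t^{\alpha}+s^{\alpha}-|t-s|^{\alpha}\right)$ for all $s,t\ge 0$. The $d$-dimensional generalized grey Brownian motion is $B^{\beta,\alpha}(t,w)=\left(\langle w_{1},M_{-}^{\alpha/2}1_{[0,t)}\rangle,\dots,\langle w_{d},M_{-}^{\alpha/2}1_{[0,t)}\rangle\right)$, each component being an element of $L^{2}(\mu_{\beta})$. $(\cdot,\cdot)$ and $|\cdot|$ on $\mathbb{R}^{d}$ denote the Euclidean inner product and norm. *)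

theory Defs
  imports "HOL-Probability.Probability"
begin

section \<open>Special functions\<close>

definition fox_wright_term ::
    "real \<times> real \<Rightarrow> real \<times> real \<Rightarrow> real \<times> real \<Rightarrow> real \<times> real \<Rightarrow> real \<Rightarrow> nat \<Rightarrow> real" where
  "fox_wright_term p1 p2 q1 q2 x j =
     Gamma (fst p1 + snd p1 * real j) * Gamma (fst p2 + snd p2 * real j) /
     (Gamma (fst q1 + snd q1 * real j) * Gamma (fst q2 + snd q2 * real j)) * (x ^ j / fact j)"

text \<open>The function \<open>2\<Psi>2\<close>; each argument pair is one column entry \<open>(a, b)\<close>, first the
  two upper pairs, then the two lower pairs.\<close>

definition fox_wright22 ::
    "real \<times> real \<Rightarrow> real \<times> real \<Rightarrow> real \<times> real \<Rightarrow> real \<times> real \<Rightarrow> real \<Rightarrow> real" where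
  "fox_wright22 p1 p2 q1 q2 x = (\<Sum>j. fox_wright_term p1 p2 q1 q2 x j)"

definition mittag_leffler :: "real \<Rightarrow> complex \<Rightarrow> complex" where
  "mittag_leffler \<beta> z = (\<Sum>j. z ^ j / complex_of_real (Gamma (\<beta> * real j + 1)))"

definition debye :: "real \<Rightarrow> real \<Rightarrow> real \<Rightarrow> real" where
  "debye y \<beta> \<alpha> =
     2 * (\<Sum>j. (- (y\<^sup>2)) ^ j / (Gamma (\<beta> * real j + 1) * (\<alpha> * real j + 1) * (\<alpha> * real j + 2)))"


section \<open>Schwartz functions and tempered distributions\<close>

definition schwartz :: "(real \<Rightarrow> real) set" where
  "schwartz = {f. (\<forall>k x. (deriv ^^ k) f differentiable (at x)) \<and>
                  (\<forall>m k. bounded (range (\<lambda>x. x ^ m * (deriv ^^ k) f x)))}"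

definition schwartz_seminorm :: "nat \<Rightarrow> nat \<Rightarrow> (real \<Rightarrow> real) \<Rightarrow> real" where
  "schwartz_seminorm m k f = (SUP x. \<bar>x ^ m * (deriv ^^ k) f x\<bar>)"

definition schwartz_topology :: "(real \<Rightarrow> real) topology" where
  "schwartz_topology = topology_generated_by
     {{g \<in> schwartz. schwartz_seminorm m k (\<lambda>x. g x - f x) < e} | m k f e. f \<in> schwartz \<and> 0 < e}"

text \<open>Distributions are taken extensional, so that two of them are equal as soon as they
  agree on all Schwartz functions.\<close>

definition tempered_distributions :: "((real \<Rightarrow> real) \<Rightarrow> real) set" where
  "tempered_distributions = {T \<in> extensional schwartz.
     (\<forall>f\<in>schwartz. \<forall>g\<in>schwartz. \<forall>a b. T (\<lambda>x. a * f x + b * g x) = a * T f + b * T g) \<and>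
     continuous_map schwartz_topology euclideanreal T}"

text \<open>\<open>d\<close>-tuples are vectors indexed by a finite type \<open>'d\<close>.\<close>

definition schwartz_vec :: "((real \<Rightarrow> real) ^ 'd) set" where
  "schwartz_vec = {\<phi>. \<forall>j. \<phi> $ j \<in> schwartz}"

definition tempered_vec :: "(((real \<Rightarrow> real) \<Rightarrow> real) ^ 'd) set" where
  "tempered_vec = {w. \<forall>j. w $ j \<in> tempered_distributions}"

definition pairing0 :: "((real \<Rightarrow> real) \<Rightarrow> real) ^ 'd \<Rightarrow> (real \<Rightarrow> real) ^ 'd::finite \<Rightarrow> real" where
  "pairing0 w \<phi> = (\<Sum>j\<in>UNIV. (w $ j) (\<phi> $ j))"

definition norm0_sq :: "(real \<Rightarrow> real) ^ 'd::finite \<Rightarrow> real" where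
  "norm0_sq \<phi> = (\<Sum>j\<in>UNIV. LINT x|lborel. ((\<phi> $ j) x)\<^sup>2)"

definition cylinder_sets :: "((((real \<Rightarrow> real) \<Rightarrow> real) ^ 'd::finite) set) set" where
  "cylinder_sets =
     {{w \<in> tempered_vec. (\<lambda>i\<in>{..<m}. pairing0 w (\<phi> i)) \<in> A} | (m::nat) \<phi> A.
        (\<forall>i<m. \<phi> i \<in> schwartz_vec) \<and> A \<in> sets (\<Pi>\<^sub>M i\<in>{..<m}. (borel :: real measure))}"


section \<open>The Mittag-Leffler measure and the extended pairing\<close>

text \<open>By the Bochner-Minlos theorem there is exactly one such measure for every
  \<open>\<beta> \<in> (0, 1]\<close>; the predicate states its defining properties.\<close>

definition mittag_leffler_measure ::
    "real \<Rightarrow> (((real \<Rightarrow> real) \<Rightarrow> real) ^ 'd::finite) measure \<Rightarrow> bool" where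
  "mittag_leffler_measure \<beta> M \<longleftrightarrow>
     prob_space M \<and> space M = tempered_vec \<and> sets M = sigma_sets tempered_vec cylinder_sets \<and>
     (\<forall>\<phi>\<in>schwartz_vec. (LINT w|M. exp (\<i> * complex_of_real (pairing0 w \<phi>))) =
        mittag_leffler \<beta> (complex_of_real (- norm0_sq \<phi> / 2)))"

definition square_integrable :: "'a measure \<Rightarrow> ('a \<Rightarrow> real) \<Rightarrow> bool" where
  "square_integrable M f \<longleftrightarrow> f \<in> borel_measurable M \<and> integrable M (\<lambda>x. (f x)\<^sup>2)"

text \<open>\<open>X\<close> is a representative of \<open>\<langle>\<cdot>, \<eta>\<rangle>\<^sub>0 \<in> L\<^sup>2(\<mu>)\<close> for \<open>\<eta> \<in> L\<^sup>2(\<real>) \<otimes> \<real>\<^sup>d\<close>: it is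
  the \<open>L\<^sup>2(\<mu>)\<close>-limit of \<open>\<langle>\<cdot>, \<phi>\<^sub>k\<rangle>\<^sub>0\<close> for Schwartz functions \<open>\<phi>\<^sub>k\<close> tending to \<open>\<eta>\<close> in
  \<open>L\<^sup>2\<close>. Since \<open>\<phi> \<mapsto> \<langle>\<cdot>, \<phi>\<rangle>\<^sub>0\<close> is bounded for the \<open>L\<^sup>2\<close> norms, this limit does not
  depend on the approximating sequence.\<close>

definition extended_pairing ::
    "(((real \<Rightarrow> real) \<Rightarrow> real) ^ 'd::finite) measure \<Rightarrow> (real \<Rightarrow> real) ^ 'd \<Rightarrow>
     (((real \<Rightarrow> real) \<Rightarrow> real) ^ 'd \<Rightarrow> real) \<Rightarrow> bool" where
  "extended_pairing M \<eta> X \<longleftrightarrow>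
     (\<forall>j. square_integrable lborel (\<eta> $ j)) \<and> square_integrable M X \<and>
     (\<exists>\<phi> :: nat \<Rightarrow> (real \<Rightarrow> real) ^ 'd.
        (\<forall>k. \<phi> k \<in> schwartz_vec \<and> square_integrable M (\<lambda>w. pairing0 w (\<phi> k))) \<and>
        (\<lambda>k. norm0_sq (\<chi> j. (\<lambda>x. (\<phi> k $ j) x - (\<eta> $ j) x))) \<longlonglongrightarrow> 0 \<and>
        (\<lambda>k. LINT w|M. (pairing0 w (\<phi> k) - X w)\<^sup>2) \<longlonglongrightarrow> 0)"


section \<open>Generalized grey Brownian motion\<close>

definition pos_powr :: "real \<Rightarrow> real \<Rightarrow> real" where
  "pos_powr u p = (if u > 0 then u powr p else 0)"

text \<open>\<open>M_half_indicator \<alpha> t\<close> is the function \<open>M\<^sub>-\<close> with exponent \<open>\<alpha>/2\<close> applied to the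
  indicator of \<open>[0, t)\<close>; for \<open>\<alpha> = 1\<close> it is this indicator itself.\<close>

definition M_half_indicator :: "real \<Rightarrow> real \<Rightarrow> real \<Rightarrow> real" where
  "M_half_indicator \<alpha> t x =
     sqrt (\<alpha> * sin (\<alpha> * pi / 2) * Gamma \<alpha>) / Gamma ((\<alpha> + 1) / 2) *
     (pos_powr (t - x) ((\<alpha> - 1) / 2) - pos_powr (- x) ((\<alpha> - 1) / 2))"

text \<open>The components of the motion are elements of \<open>L\<^sup>2(\<mu>)\<close>, that is, classes modulo
  null sets. The predicate holds for every choice \<open>B\<close> of representatives.\<close>

definition generalized_grey_BM ::
    "real \<Rightarrow> (((real \<Rightarrow> real) \<Rightarrow> real) ^ 'd::finite) measure \<Rightarrow>
     (real \<Rightarrow> ((real \<Rightarrow> real) \<Rightarrow> real) ^ 'd \<Rightarrow> real ^ 'd) \<Rightarrow> bool" where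
  "generalized_grey_BM \<alpha> M B \<longleftrightarrow>
     (\<forall>t\<ge>0. \<forall>j. extended_pairing M
        (\<chi> i. if i = j then M_half_indicator \<alpha> t else (\<lambda>_. 0)) (\<lambda>w. B t w $ j))"

definition form_factor ::
    "'w measure \<Rightarrow> (real \<Rightarrow> 'w \<Rightarrow> real ^ 'd::finite) \<Rightarrow> nat \<Rightarrow> real ^ 'd \<Rightarrow> complex" where
  "form_factor M B n k = 1 / (of_nat n)\<^sup>2 *
     (LINT t:{0..real n}|lborel. LINT s:{0..real n}|lborel.
        LINT w|M. exp (\<i> * complex_of_real (k \<bullet> (B t w - B s w))))"

end

theory Submission
  imports Defs "HOL-Real_Asymp.Real_Asymp"
begin

text \<open>The increment \<open>(k, B(t) - B(s))\<close> is the extended pairing with \<open>k \<otimes> (M t - M s)\<close>, where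
  \<open>M t = M_half_indicator \<alpha> t\<close>. Being an \<open>L\<^sup>2\<close>-limit of pairings with Schwartz functions, it has the
  characteristic function \<open>E\<^sub>\<beta>(- |k|\<^sup>2 |t - s|\<^sup>\<alpha> / 2)\<close>, because \<open>M t - M s\<close> has squared \<open>L\<^sup>2\<close> norm
  \<open>|t - s|\<^sup>\<alpha>\<close>. The Mittag-Leffler series is then integrated term by term over the square.

  By translation and scaling the norm of \<open>M t - M s\<close> reduces to the Mandelbrot-Van Ness integral
  \<open>1/\<alpha> + \<integral> ((1 + x)\<^sup>p - x\<^sup>p)\<^sup>2 dx\<close> over the half line, with \<open>p = (\<alpha> - 1)/2\<close>. Up to an explicit
  derivative the integrand is \<open>(1 - p)/\<alpha> \<cdot> x\<^sup>p (1 + x)\<^bsup>p - 2\<^esup>\<close>, whose integral is a Beta value, and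
  the reflection formula turns the result into the normalizing constant.\<close>

section \<open>The Mittag-Leffler series, and the Gamma and Beta identities\<close>

section \<open>Special functions and their series\<close>

text \<open>Choosing \<open>R\<close> with \<open>R powr \<beta> = 2 (|x| + 1)\<close> makes the Mittag-Leffler series geometric.\<close>

lemma Gamma_plus1_ge:
  fixes s R :: real
  assumes "s \<ge> 0" "R > 0"
  shows "R powr s * exp (- R) \<le> Gamma (s + 1)"
proof -
  \<comment> \<open>The tail of the Gamma integral beyond \<open>R\<close> is enough: there
    \<open>t powr s\<close> is at least \<open>R powr s\<close>, and \<open>exp (- t)\<close>
    integrates to \<open>exp (- R)\<close>.\<close>
  have 1: "((\<lambda>x. R powr s * exp (- 1 * x)) has_integral R powr s * (exp (- 1 * R) / 1)) {R..}"
    by (intro has_integral_mult_right has_integral_exp_minus_to_infinity) simp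
  have 2: "((\<lambda>x. if x \<in> {R..} then R powr s * exp (- 1 * x) else 0)
        has_integral R powr s * (exp (- 1 * R) / 1)) {0..}"
    using assms by (intro has_integral_on_superset[OF has_integral_eq[OF _ 1]]) auto
  have 3: "((\<lambda>t. t powr s / exp t) has_integral Gamma (s + 1)) {0..}"
    using Gamma_integral_real[of "s + 1"] assms by simp
  have "R powr s * (exp (- 1 * R) / 1) \<le> Gamma (s + 1)"
    by (rule has_integral_le[OF 2 3]) (use assms in \<open>auto simp: exp_minus field_simps powr_mono2\<close>)
  then show ?thesis by simp
qed

lemma Gamma_linear_pos: "0 < \<beta> \<Longrightarrow> 0 < Gamma (\<beta> * real j + 1)"
  by (intro Gamma_real_pos add_nonneg_pos) auto

lemma summable_mittag_leffler_real:
  fixes x \<beta> :: real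
  assumes \<beta>: "0 < \<beta>"
  shows "summable (\<lambda>j. \<bar>x\<bar> ^ j / Gamma (\<beta> * real j + 1))"
proof -
  define R where "R = (2 * (\<bar>x\<bar> + 1)) powr (1 / \<beta>)"
  have R: "R > 0" unfolding R_def by (auto simp: add_nonneg_pos)
  have Rp: "R powr (\<beta> * real j) = (2 * (\<bar>x\<bar> + 1)) ^ j" for j
    using \<beta> unfolding R_def powr_powr by (simp add: powr_realpow add_nonneg_pos)
  show ?thesis
  proof (rule summable_comparison_test')
    show "summable (\<lambda>j. exp R * (1 / 2) ^ j)" by (intro summable_mult summable_geometric) simp
    fix j :: nat
    have "\<bar>x\<bar> ^ j / Gamma (\<beta> * real j + 1) \<le> \<bar>x\<bar> ^ j / (R powr (\<beta> * real j) * exp (- R))"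
      using Gamma_plus1_ge[of "\<beta> * real j" R] R \<beta> Gamma_linear_pos[of \<beta> j] by (intro divide_left_mono) auto
    also have "\<dots> = exp R * (\<bar>x\<bar> / (2 * (\<bar>x\<bar> + 1))) ^ j"
      unfolding Rp power_divide by (simp add: exp_minus divide_inverse mult.commute)
    also have "\<dots> \<le> exp R * (1 / 2) ^ j"
      by (intro mult_left_mono power_mono) (auto simp: divide_le_eq)
    finally show "norm (\<bar>x\<bar> ^ j / Gamma (\<beta> * real j + 1)) \<le> exp R * (1 / 2) ^ j"
      using Gamma_linear_pos[of \<beta> j] \<beta> by simp
  qed
qed

lemma summable_mittag_leffler_complex:
  assumes "0 < \<beta>"
  shows "summable (\<lambda>j. z ^ j / complex_of_real (Gamma (\<beta> * real j + 1)))"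
proof (rule summable_norm_cancel)
  show "summable (\<lambda>j. norm (z ^ j / complex_of_real (Gamma (\<beta> * real j + 1))))"
    using summable_mittag_leffler_real[OF assms, of "norm z"] Gamma_linear_pos[OF assms]
    by (simp add: norm_divide norm_power abs_of_pos)
qed

text \<open>A power series with infinite radius of convergence. Continuity is what lets the defining
  formula of the measure pass from Schwartz functions to their limits.\<close>

lemma isCont_mittag_leffler:
  assumes "0 < \<beta>"
  shows "isCont (mittag_leffler \<beta>) z"
proof -
  have "isCont (\<lambda>z. \<Sum>j. (1 / complex_of_real (Gamma (\<beta> * real j + 1))) * z ^ j) z"
    using summable_mittag_leffler_complex[OF assms] by (intro isCont_powser_converges_everywhere) simp
  then show ?thesis by (simp add: mittag_leffler_def[abs_def])
qed

text \<open>Only real arguments occur in the form factor, so all later termwise integration can be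
  done with real series.\<close>

lemma mittag_leffler_of_real:
  assumes "0 < \<beta>"
  shows "mittag_leffler \<beta> (complex_of_real x) =
    complex_of_real (\<Sum>j. x ^ j / Gamma (\<beta> * real j + 1))"
proof -
  have "summable (\<lambda>j. norm (x ^ j / Gamma (\<beta> * real j + 1)))"
    using summable_mittag_leffler_real[OF assms, of x] Gamma_linear_pos[OF assms]
    by (simp add: abs_of_pos power_abs)
  then have "summable (\<lambda>j. x ^ j / Gamma (\<beta> * real j + 1))" by (rule summable_norm_cancel)
  from suminf_of_real[OF this, where 'a = complex] show ?thesis
    by (simp add: mittag_leffler_def)
qed

text \<open>Two uses of the functional equation write \<open>Gamma (3 + \<alpha> * real j)\<close>
  as \<open>(\<alpha> * real j + 2) * (\<alpha> * real j + 1)\<close> times the first numerator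
  factor, which cancels; the second numerator factor cancels the factorial.\<close>

lemma fox_wright_term_eq:
  assumes "0 < \<alpha>" "0 < \<beta>"
  shows "fox_wright_term (1, \<alpha>) (1, 1) (1, \<beta>) (3, \<alpha>) z j =
    1 / (Gamma (\<beta> * real j + 1) * (\<alpha> * real j + 1) * (\<alpha> * real j + 2)) * z ^ j"
proof -
  have p: "0 < \<alpha> * real j + 1" using assms by (simp add: add_nonneg_pos)
  have "Gamma (\<alpha> * real j + 1 + 1) = (\<alpha> * real j + 1) * Gamma (\<alpha> * real j + 1)"
    using p by (intro Gamma_plus1) auto
  moreover have "Gamma (\<alpha> * real j + 1 + 1 + 1) = (\<alpha> * real j + 1 + 1) * Gamma (\<alpha> * real j + 1 + 1)"
    using p by (intro Gamma_plus1) (auto elim!: nonpos_Ints_cases)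
  ultimately have "Gamma (3 + \<alpha> * real j) = (\<alpha> * real j + 2) * (\<alpha> * real j + 1) * Gamma (1 + \<alpha> * real j)"
    by (simp add: algebra_simps)
  moreover have "Gamma (1 + \<alpha> * real j) \<noteq> 0" "Gamma (1 + \<beta> * real j) \<noteq> 0"
    using Gamma_linear_pos[of \<alpha> j] Gamma_linear_pos[of \<beta> j] assms by (simp_all add: add.commute)
  moreover have "Gamma (1 + real j) = fact j" by (simp add: Gamma_fact)
  ultimately show ?thesis
    using p by (simp add: fox_wright_term_def divide_simps) (simp add: add_ac mult_ac)
qed

text \<open>At an integer both sides are 0 by convention: one Gamma factor sits at a pole, and the
  right side divides by 0.\<close>

lemma Gamma_reflection_real:
  fixes x :: real
  shows "Gamma x * Gamma (1 - x) = pi / sin (pi * x)"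
proof -
  have "complex_of_real (Gamma x * Gamma (1 - x)) = complex_of_real (pi / sin (pi * x))"
    using Gamma_reflection_complex[of "complex_of_real x"]
    by (simp flip: Gamma_complex_of_real sin_of_real)
  then show ?thesis unfolding of_real_eq_iff .
qed

text \<open>Reflection at \<alpha> produces \<open>sin (pi * \<alpha>)\<close>, reflection at
  \<open>(\<alpha> + 1) / 2\<close> produces \<open>cos (\<alpha> * pi / 2)\<close>, and the double
  angle formula relates the two. The value \<alpha> = 1 is treated apart because
  \<open>Gamma (1 - \<alpha>)\<close> and \<open>Gamma ((1 - \<alpha>) / 2)\<close> have poles
  there.\<close>

lemma Gamma_half_reflection:
  fixes \<alpha> :: real
  assumes "0 < \<alpha>" "\<alpha> < 2"
  shows "Gamma (2 - \<alpha>) * (Gamma \<alpha> * sin (\<alpha> * pi / 2)) = Gamma ((\<alpha> + 1) / 2) * Gamma ((3 - \<alpha>) / 2)"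
proof (cases "\<alpha> = 1")
  case True
  then show ?thesis by simp
next
  case False
  have ni: "1 - \<alpha> \<notin> \<int>\<^sub>\<le>\<^sub>0" "(1 - \<alpha>) / 2 \<notin> \<int>\<^sub>\<le>\<^sub>0"
  proof -
    have *: "x \<notin> \<int>\<^sub>\<le>\<^sub>0" if "x > -1" "x \<noteq> 0" for x :: real
    proof
      assume "x \<in> \<int>\<^sub>\<le>\<^sub>0"
      then obtain n where "x = of_int n" "n \<le> 0" by (auto elim!: nonpos_Ints_cases)
      then show False using that by auto
    qed
    show "1 - \<alpha> \<notin> \<int>\<^sub>\<le>\<^sub>0" by (rule *) (use assms False in auto)
    show "(1 - \<alpha>) / 2 \<notin> \<int>\<^sub>\<le>\<^sub>0" by (rule *) (use assms False in auto)
  qed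
  have 1: "Gamma (2 - \<alpha>) = (1 - \<alpha>) * Gamma (1 - \<alpha>)" using Gamma_plus1[OF ni(1)] by simp
  have 2: "Gamma ((3 - \<alpha>) / 2) = (1 - \<alpha>) / 2 * Gamma ((1 - \<alpha>) / 2)"
    using Gamma_plus1[OF ni(2)] by (simp add: field_simps)
  have 3: "Gamma \<alpha> * Gamma (1 - \<alpha>) = pi / sin (pi * \<alpha>)" by (rule Gamma_reflection_real)
  have "Gamma ((\<alpha> + 1) / 2) * Gamma (1 - (\<alpha> + 1) / 2) = pi / sin (pi * ((\<alpha> + 1) / 2))"
    by (rule Gamma_reflection_real)
  moreover have "1 - (\<alpha> + 1) / 2 = (1 - \<alpha>) / 2" by (simp add: field_simps)
  moreover have "sin (pi * ((\<alpha> + 1) / 2)) = cos (\<alpha> * pi / 2)"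
  proof -
    have "pi * ((\<alpha> + 1) / 2) = \<alpha> * pi / 2 + pi / 2" by (simp add: algebra_simps add_divide_distrib)
    then show ?thesis by (simp only: sin_add) simp
  qed
  ultimately have 4: "Gamma ((\<alpha> + 1) / 2) * Gamma ((1 - \<alpha>) / 2) = pi / cos (\<alpha> * pi / 2)" by simp
  have 5: "sin (pi * \<alpha>) = 2 * sin (\<alpha> * pi / 2) * cos (\<alpha> * pi / 2)"
    using sin_double[of "\<alpha> * pi / 2"] by (simp add: mult_ac)
  have "0 < \<alpha> * pi / 2" "\<alpha> * pi / 2 < pi" using assms by auto
  then have 6: "sin (\<alpha> * pi / 2) > 0" by (rule sin_gt_zero)
  have "Gamma (2 - \<alpha>) * (Gamma \<alpha> * sin (\<alpha> * pi / 2)) =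
      (1 - \<alpha>) * (Gamma \<alpha> * Gamma (1 - \<alpha>)) * sin (\<alpha> * pi / 2)"
    unfolding 1 by simp
  also have "\<dots> = (1 - \<alpha>) / 2 * (Gamma ((\<alpha> + 1) / 2) * Gamma ((1 - \<alpha>) / 2))"
    unfolding 3 4 5 using 6 by (simp add: divide_simps)
  also have "\<dots> = Gamma ((\<alpha> + 1) / 2) * Gamma ((3 - \<alpha>) / 2)" unfolding 2 by simp
  finally show ?thesis .
qed

text \<open>The substitution \<open>x = t / (1 - t)\<close>, with derivative
  \<open>1 / (1 - t)^2\<close>, carries the unit interval onto the half line and turns the integrand
  into the classical Beta integrand. Absolute integrability comes along because the change of
  variables theorem transports both facts together.\<close>

lemma Beta_half_line_integral:
  fixes a b :: real
  assumes a: "a > 0" and b: "b > 0"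
  shows "(\<lambda>x. x powr (a - 1) * (1 + x) powr (- a - b)) absolutely_integrable_on {0<..} \<and>
    integral {0<..} (\<lambda>x. x powr (a - 1) * (1 + x) powr (- a - b)) = Beta a b"
proof -
  define g where "g = (\<lambda>t::real. t / (1 - t))"
  define f where "f = (\<lambda>x::real. x powr (a - 1) * (1 + x) powr (- a - b))"
  have inj: "inj_on g {0<..<1}" by (auto simp: inj_on_def g_def field_simps)
  have img: "g ` {0<..<1} = {0<..}"
  proof (intro equalityI subsetI)
    fix x :: real assume "x \<in> {0<..}"
    then have "g (x / (1 + x)) = x" "x / (1 + x) \<in> {0<..<1}" by (auto simp: g_def field_simps)
    then show "x \<in> g ` {0<..<1}" by (metis imageI)
  qed (auto simp: g_def)
  have eq: "\<bar>1 / (1 - t)\<^sup>2\<bar> * f (g t) = t powr (a - 1) * (1 - t) powr (b - 1)" if "t \<in> {0<..<1}" for t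
  proof -
    have "1 + g t = 1 / (1 - t)" using that by (simp add: g_def field_simps)
    moreover have "\<bar>1 / (1 - t)\<^sup>2\<bar> = (1 - t) powr (- 2)" using that
      by (simp add: powr_minus inverse_eq_divide powr_realpow[of "1 - t" 2, simplified])
    ultimately have "\<bar>1 / (1 - t)\<^sup>2\<bar> * f (g t) =
        t powr (a - 1) * ((1 - t) powr (- 2) * (1 - t) powr (1 - a) * (1 - t) powr (a + b))"
      using that by (simp add: f_def g_def powr_divide powr_minus_divide powr_minus powr_diff powr_add field_simps)
    then show ?thesis using that by (simp flip: powr_add)
  qed
  have I: "((\<lambda>t. t powr (a - 1) * (1 - t) powr (b - 1)) has_integral Beta a b) {0<..<1}"
    using has_integral_Beta_real[OF a b] by (simp add: has_integral_Icc_iff_Ioo)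
  have I': "((\<lambda>t. \<bar>1 / (1 - t)\<^sup>2\<bar> * f (g t)) has_integral Beta a b) {0<..<1}"
    by (rule has_integral_eq[OF _ I]) (use eq in auto)
  have "(\<lambda>t. \<bar>1 / (1 - t)\<^sup>2\<bar> * f (g t)) absolutely_integrable_on {0<..<1} \<and>
      integral {0<..<1} (\<lambda>t. \<bar>1 / (1 - t)\<^sup>2\<bar> * f (g t)) = Beta a b"
    using I' by (auto intro!: nonnegative_absolutely_integrable_1 simp: f_def integrable_on_def)
  also have "?this \<longleftrightarrow> f absolutely_integrable_on (g ` {0<..<1}) \<and> integral (g ` {0<..<1}) f = Beta a b"
    by (intro has_absolute_integral_change_of_variables_1' inj)
      (auto simp: g_def field_simps power2_eq_square intro!: derivative_eq_intros)
  finally show ?thesis unfolding img f_def .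
qed

section \<open>The Mandelbrot-Van Ness kernel and its normalization\<close>

section \<open>The norm of the increments\<close>

lemma powr_double:
  fixes x p :: real
  shows "x powr (2 * p) = (x powr p)\<^sup>2"
  by (metis mult_2 powr_add power2_eq_square)

text \<open>On the left the terms of order \<open>x powr \<alpha>\<close> and
  \<open>x powr (\<alpha> - 1)\<close> cancel at infinity. Factoring out
  \<open>x powr (\<alpha> - 2)\<close> makes this visible, since \<open>q\<close> tends to 1 and
  \<open>(q - 1) * x\<close> tends to \<open>p\<close>.\<close>

lemma kernel_primitive_eq:
  fixes x p :: real
  assumes x: "x > 0" and p: "\<alpha> = 2 * p + 1"
  defines "q \<equiv> (1 + 1 / x) powr p"
  shows "(1 + x) powr \<alpha> + x powr \<alpha> - 2 * (x powr (p + 1) * (1 + x) powr p)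
           - x powr (p + 1) * (1 + x) powr (p - 1) =
    x powr (\<alpha> - 2) * (((q - 1) * x)\<^sup>2 + q * ((q - 1) * x * (1 + 1 / x) + 1) / (1 + 1 / x))"
proof -
  define w where "w = x powr p"
  have e: "1 + x = x * (1 + 1 / x)" using x by (simp add: field_simps)
  have 1: "(1 + x) powr p = w * q" unfolding e w_def q_def using x by (simp add: powr_mult)
  have 2: "(1 + x) powr \<alpha> = (w * q)\<^sup>2 * (1 + x)"
    using x unfolding 1[symmetric] by (simp add: p powr_add powr_double)
  have 3: "(1 + x) powr (p - 1) = w * q / (1 + x)"
    using x unfolding 1[symmetric] by (simp add: powr_diff)
  have 4: "x powr \<alpha> = w\<^sup>2 * x" "x powr (p + 1) = w * x" "x powr (\<alpha> - 2) = w\<^sup>2 / x"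
    using x unfolding w_def by (simp_all add: p powr_add powr_diff powr_double power2_eq_square)
  define r where "r = 1 + x"
  have r: "r > 0" "1 + 1 / x = r / x" using x by (auto simp: r_def add_divide_distrib)
  have "(q - 1) * x * (r / x) + 1 = (q - 1) * r + 1" using x by simp
  also have "\<dots> = q * r - x" by (simp add: r_def algebra_simps)
  finally have 5: "(q - 1) * x * (r / x) + 1 = q * r - x" .
  have 6: "q * (q * r - x) / (r / x) = (q\<^sup>2 - q * x / r) * x"
    using x r(1) by (simp add: diff_divide_distrib power2_eq_square right_diff_distrib left_diff_distrib)
  have "(w * q)\<^sup>2 * r + w\<^sup>2 * x - 2 * (w * x * (w * q)) - w * x * (w * q / r) =
      w\<^sup>2 * ((q - 1)\<^sup>2 * x + (q\<^sup>2 - q * x / r))"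
    by (simp add: algebra_simps power2_eq_square r_def)
  also have "\<dots> = w\<^sup>2 / x * (((q - 1) * x)\<^sup>2 + (q\<^sup>2 - q * x / r) * x)"
    using x by (simp add: power_mult_distrib distrib_left) (simp add: power2_eq_square)
  finally show ?thesis unfolding 1 2 3 4 unfolding r_def[symmetric] r(2) 5 6 .
qed

text \<open>The bracket in \<open>kernel_primitive_eq\<close> converges to
  \<open>p^2 + p + 1\<close>, while its prefactor \<open>x powr (\<alpha> - 2)\<close> vanishes;
  this is where \<alpha> < 2 enters.\<close>

lemma kernel_primitive_tendsto_0:
  fixes \<alpha> p :: real
  assumes \<alpha>: "\<alpha> < 2" and p: "\<alpha> = 2 * p + 1"
  shows "((\<lambda>x. (1 + x) powr \<alpha> + x powr \<alpha> - 2 * (x powr (p + 1) * (1 + x) powr p)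
           - x powr (p + 1) * (1 + x) powr (p - 1)) \<longlongrightarrow> 0) at_top"
proof -
  define q where "q = (\<lambda>x::real. (1 + 1 / x) powr p)"
  have q: "(q \<longlongrightarrow> 1) at_top" unfolding q_def by real_asymp
  have u: "((\<lambda>x. (q x - 1) * x) \<longlongrightarrow> p) at_top" unfolding q_def by real_asymp
  have "((\<lambda>x::real. x powr (\<alpha> - 2)) \<longlongrightarrow> 0) at_top"
    using \<alpha> by (intro tendsto_neg_powr filterlim_ident) auto
  moreover have "((\<lambda>x::real. 1 + 1 / x) \<longlongrightarrow> 1) at_top" by real_asymp
  ultimately have "((\<lambda>x. x powr (\<alpha> - 2) * (((q x - 1) * x)\<^sup>2 +
      q x * ((q x - 1) * x * (1 + 1 / x) + 1) / (1 + 1 / x))) \<longlongrightarrow>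
      0 * (p\<^sup>2 + 1 * (p * 1 + 1) / 1)) at_top"
    by (intro tendsto_intros q u) auto
  moreover have "\<forall>\<^sub>F x in at_top. x powr (\<alpha> - 2) * (((q x - 1) * x)\<^sup>2 +
      q x * ((q x - 1) * x * (1 + 1 / x) + 1) / (1 + 1 / x)) =
      (1 + x) powr \<alpha> + x powr \<alpha> - 2 * (x powr (p + 1) * (1 + x) powr p)
           - x powr (p + 1) * (1 + x) powr (p - 1)"
    using eventually_gt_at_top[of "0::real"]
    by eventually_elim (simp only: kernel_primitive_eq[OF _ p] q_def)
  ultimately show ?thesis by (simp add: tendsto_cong)
qed

text \<open>A gauge integral over an unbounded set is approximated on every box that contains a
  large ball; for \<open>y \<ge> B\<close> the box from \<open>- y\<close> to \<open>y\<close> is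
  such a box.\<close>

lemma tendsto_integral_half_line:
  fixes g :: "real \<Rightarrow> real"
  assumes "(g has_integral b) {0..}"
  shows "((\<lambda>y. integral {0..y} g) \<longlongrightarrow> b) at_top"
proof (rule tendstoI)
  fix e :: real assume "e > 0"
  with assms obtain B where B: "B > 0" "\<And>u v. ball 0 B \<subseteq> cbox u v \<Longrightarrow>
      norm (integral (cbox u v) (\<lambda>x. if x \<in> {0..} then g x else 0) - b) < e"
    unfolding has_integral_alt'[of g b] by meson
  show "\<forall>\<^sub>F y in at_top. dist (integral {0..y} g) b < e"
    using eventually_ge_at_top[of B]
  proof eventually_elim
    case (elim y)
    have "ball 0 B \<subseteq> cbox (- y) y" using elim by (auto simp: dist_norm)
    from B(2)[OF this] have "norm (integral {- y..y} (\<lambda>x. if x \<in> {0..} then g x else 0) - b) < e"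
      by simp
    also have "integral {- y..y} (\<lambda>x. if x \<in> {0..} then g x else 0) = integral ({0..} \<inter> {- y..y}) g"
      by (rule integral_restrict_Int)
    also have "{0..} \<inter> {- y..y} = {0..y}" using elim B(1) by auto
    finally show ?case by (simp add: dist_norm)
  qed
qed

text \<open>The primitive part \<open>G\<close> vanishes at infinity and equals
  \<open>1 / \<alpha>\<close> at 0, which accounts for the summand \<open>- 1 / \<alpha>\<close>;
  the remaining multiple of \<open>g\<close> gives the Beta value.\<close>

lemma kernel_has_integral_half_line:
  fixes \<alpha> p :: real
  assumes \<alpha>: "0 < \<alpha>" "\<alpha> < 2" and p: "\<alpha> = 2 * p + 1"
  shows "((\<lambda>x. ((1 + x) powr p - x powr p)\<^sup>2) has_integral
     (1 - p) / \<alpha> * Beta (p + 1) (1 - 2 * p) - 1 / \<alpha>) {0..}"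
proof -
  \<comment> \<open>\<open>f = G' + c g\<close>, found by twice reducing the exponent in \<open>x\<^sup>p (1 + x)\<^sup>p\<close> by parts until it is
    integrable at infinity.\<close>
  define G where "G = (\<lambda>x. ((1 + x) powr \<alpha> + x powr \<alpha> - 2 * (x powr (p + 1) * (1 + x) powr p)
           - x powr (p + 1) * (1 + x) powr (p - 1)) / \<alpha>)"
  define g where "g = (\<lambda>x. x powr p * (1 + x) powr (p - 2))"
  define f where "f = (\<lambda>x. ((1 + x) powr p - x powr p)\<^sup>2)"
  define c where "c = (1 - p) / \<alpha>"
  have pp: "p > -1" "p + 1 > 0" "1 - 2 * p > 0" using \<alpha> p by auto
  have "g absolutely_integrable_on {0<..} \<and> integral {0<..} g = Beta (p + 1) (1 - 2 * p)"
    using Beta_half_line_integral[OF pp(2,3)] by (simp add: g_def)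
  then have gI: "(g has_integral Beta (p + 1) (1 - 2 * p)) {0<..}"
    using set_lebesgue_integral_eq_integral(1) by (metis integrable_integral)
  have neg: "negligible {x \<in> {0..} - {0<..}. g x \<noteq> 0}" "negligible {x \<in> {0<..} - {0..}. g x \<noteq> 0}"
    by (rule negligible_subset[OF negligible_sing[of 0]], simp add: subset_eq)+
  have g: "(g has_integral Beta (p + 1) (1 - 2 * p)) {0..}"
    by (rule iffD2[OF has_integral_spike_set_eq[OF neg] gI])
  have gi: "g integrable_on {0..y}" for y
    using g by (rule integrable_on_subinterval[OF has_integral_integrable]) auto
  have DG: "(G has_real_derivative f x - c * g x) (at x)" if x: "x > 0" for x
  proof -
    define w where "w = x powr p"
    define v where "v = (1 + x) powr p"
    have vs: "(1 + x) powr (p - 1) = v / (1 + x)" "(1 + x) powr (p - 1 - 1) = v / (1 + x)\<^sup>2"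
      "(1 + x) powr (p - 2) = v / (1 + x)\<^sup>2" "(1 + x) powr (\<alpha> - 1) = v\<^sup>2"
      using x by (simp_all add: v_def p powr_diff powr_double power2_eq_square)
    have ws: "x powr (p + 1) = w * x" "x powr (p + 1 - 1) = w" "x powr (\<alpha> - 1) = w\<^sup>2"
      using x by (simp_all add: w_def p powr_add powr_double)
    have "(G has_real_derivative (\<alpha> * (1 + x) powr (\<alpha> - 1) + \<alpha> * x powr (\<alpha> - 1)
       - 2 * ((p + 1) * x powr (p + 1 - 1) * (1 + x) powr p
              + x powr (p + 1) * (p * (1 + x) powr (p - 1)))
       - ((p + 1) * x powr (p + 1 - 1) * (1 + x) powr (p - 1)
              + x powr (p + 1) * ((p - 1) * (1 + x) powr (p - 1 - 1)))) / \<alpha>) (at x)"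
      unfolding G_def using x \<alpha> by (auto intro!: derivative_eq_intros)
    also have "(\<alpha> * (1 + x) powr (\<alpha> - 1) + \<alpha> * x powr (\<alpha> - 1)
       - 2 * ((p + 1) * x powr (p + 1 - 1) * (1 + x) powr p
              + x powr (p + 1) * (p * (1 + x) powr (p - 1)))
       - ((p + 1) * x powr (p + 1 - 1) * (1 + x) powr (p - 1)
              + x powr (p + 1) * ((p - 1) * (1 + x) powr (p - 1 - 1)))) / \<alpha> = f x - c * g x"
    proof -
      \<comment> \<open>In terms of \<open>i\<close> the single relation
        \<open>x * i = 1 - i\<close> eliminates \<open>x\<close>, and the claim becomes a polynomial
        identity in \<open>v\<close>, \<open>w\<close> and \<open>i\<close>.\<close>
      define i where "i = 1 / (1 + x)"
      have i: "v / (1 + x) = v * i" "v / (1 + x)\<^sup>2 = v * i\<^sup>2"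
        by (simp_all add: i_def power_divide)
      have xi: "x * i = 1 - i" using x by (simp add: i_def field_simps)
      have "\<alpha> * v\<^sup>2 + \<alpha> * w\<^sup>2 - 2 * ((p + 1) * w * v + w * x * (p * (v * i)))
          - ((p + 1) * w * (v * i) + w * x * ((p - 1) * (v * i\<^sup>2))) =
        \<alpha> * v\<^sup>2 + \<alpha> * w\<^sup>2 - 2 * (p + 1) * w * v - 2 * p * w * v * (x * i)
          - (p + 1) * w * v * i - (p - 1) * w * v * i * (x * i)"
        by (simp add: algebra_simps power2_eq_square)
      also have "\<dots> = \<alpha> * (v - w)\<^sup>2 - (1 - p) * (w * (v * i\<^sup>2))"
        unfolding xi by (simp add: p algebra_simps power2_eq_square)
      also have "\<dots> / \<alpha> = (v - w)\<^sup>2 - (1 - p) / \<alpha> * (w * (v * i\<^sup>2))" 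
        using \<alpha>(1) by (subst diff_divide_distrib) simp
      finally show ?thesis
        unfolding f_def g_def c_def vs ws v_def[symmetric] w_def[symmetric] i .
    qed
    finally show ?thesis .
  qed
  \<comment> \<open>For \<open>p < 0\<close> the derivative of \<open>G\<close> blows up at 0.
    Continuity at 0 survives because \<alpha> and \<open>p + 1\<close> are positive, and the
    fundamental theorem asks for the derivative only in the interior.\<close>
  have cG: "continuous_on {0..y} G" for y
  proof -
    have 1: "continuous_on {0..y} (\<lambda>x. x powr a)" if "a > 0" for a :: real
      using that by (intro continuous_on_powr' continuous_on_id continuous_on_const) auto
    have 2: "continuous_on {0..y} (\<lambda>x. (1 + x) powr a)" for a :: real
      by (intro continuous_on_powr continuous_intros) auto
    show ?thesis unfolding G_def using \<alpha> pp
      by (intro continuous_on_diff continuous_on_add continuous_on_mult continuous_on_divide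
          continuous_on_const 1 2) auto
  qed
  have fi: "(f has_integral (G y - G 0) + c * integral {0..y} g) {0..y}" if "y \<ge> 0" for y
  proof -
    have "((\<lambda>x. f x - c * g x) has_integral (G y - G 0)) {0..y}"
      using DG that by (intro fundamental_theorem_of_calculus_interior cG)
        (auto simp flip: has_real_derivative_iff_has_vector_derivative)
    from has_integral_add[OF this has_integral_mult_right[OF integrable_integral[OF gi], of c]]
    show ?thesis by simp
  qed
  have G0: "G 0 = 1 / \<alpha>" using \<alpha> pp by (simp add: G_def)
  \<comment> \<open>Since \<open>f\<close> is nonnegative, convergence of its integrals over
    \<open>{0..y}\<close> already gives the integral over the half line.\<close>
  have "(f has_integral 0 - G 0 + c * Beta (p + 1) (1 - 2 * p)) {0..}"
  proof (rule has_integral_to_inf)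
    show "f integrable_on {0..y}" for y
      using fi[of y] by (cases "y \<ge> 0") (auto simp: integrable_on_def)
    have "(G \<longlongrightarrow> 0 / \<alpha>) at_top"
      unfolding G_def using \<alpha> by (intro tendsto_divide kernel_primitive_tendsto_0 p) auto
    then have "((\<lambda>y. G y - G 0 + c * integral {0..y} g) \<longlongrightarrow> 0 - G 0 + c * Beta (p + 1) (1 - 2 * p)) at_top"
      by (intro tendsto_intros tendsto_integral_half_line g) simp
    moreover have "\<forall>\<^sub>F y in at_top. G y - G 0 + c * integral {0..y} g = integral {0..y} f"
      using eventually_ge_at_top[of 0] by eventually_elim (rule integral_unique[OF fi, symmetric])
    ultimately show "((\<lambda>y. integral {0..y} f) \<longlongrightarrow> 0 - G 0 + c * Beta (p + 1) (1 - 2 * p)) at_top"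
      by (rule Lim_transform_eventually)
  qed (simp add: f_def)
  then show ?thesis unfolding f_def c_def G0 by (simp add: algebra_simps)
qed

text \<open>For a nonnegative function the gauge and Lebesgue integrals agree. This moves the
  computation to \<open>lborel\<close>, where the affine substitution is made.\<close>

lemma has_bochner_integral_has_integral_nonneg:
  fixes f :: "real \<Rightarrow> real"
  assumes "f \<in> borel_measurable borel" "\<And>x. 0 \<le> f x" "(f has_integral r) UNIV"
  shows "has_bochner_integral lborel f r"
proof (rule has_bochner_integral_nn_integral)
  show "0 \<le> r" using assms by (blast intro: has_integral_nonneg)
  show "(\<integral>\<^sup>+ x. ennreal (f x) \<partial>lborel) = ennreal r"
    using assms by (intro nn_integral_has_integral_lborel) auto
qed (use assms in auto)

text \<open>Between -1 and 0 only the first power is present, and its square integrates to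
  \<open>1 / \<alpha>\<close>, which cancels the \<open>- 1 / \<alpha>\<close> from the half line.
  To the left of -1 both powers vanish.\<close>

lemma kernel_has_bochner_integral:
  fixes \<alpha> p :: real
  assumes \<alpha>: "0 < \<alpha>" "\<alpha> < 2" and p: "\<alpha> = 2 * p + 1"
  shows "has_bochner_integral lborel (\<lambda>x. (pos_powr (1 + x) p - pos_powr x p)\<^sup>2)
     ((1 - p) / \<alpha> * Beta (p + 1) (1 - 2 * p))"
proof (rule has_bochner_integral_has_integral_nonneg)
  let ?f = "\<lambda>x. (pos_powr (1 + x) p - pos_powr x p)\<^sup>2"
  show "?f \<in> borel_measurable borel" unfolding pos_powr_def by measurable
  have "((\<lambda>x. (1 + x) powr (2 * p)) has_integral ((1 + 0) powr \<alpha> / \<alpha> - (1 + (-1)) powr \<alpha> / \<alpha>)) {-1..0}"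
  proof (rule fundamental_theorem_of_calculus_interior)
    show "continuous_on {-1..0} (\<lambda>x. (1 + x) powr \<alpha> / \<alpha>)"
      using \<alpha> by (intro continuous_on_divide continuous_on_powr' continuous_intros) auto
    fix x :: real assume "x \<in> {-1<..<0}"
    then have "((\<lambda>x. (1 + x) powr \<alpha> / \<alpha>) has_real_derivative (1 + x) powr (2 * p)) (at x)"
      using \<alpha> by (auto intro!: derivative_eq_intros simp: p)
    then show "((\<lambda>x. (1 + x) powr \<alpha> / \<alpha>) has_vector_derivative (1 + x) powr (2 * p)) (at x)"
      by (simp add: has_real_derivative_iff_has_vector_derivative)
  qed simp
  then have "((\<lambda>x. (1 + x) powr (2 * p)) has_integral 1 / \<alpha>) {-1..0}" using \<alpha> by simp
  then have 1: "(?f has_integral 1 / \<alpha>) {-1..0}"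
    by (rule has_integral_spike_finite[of "{-1}", rotated 2])
      (auto simp: pos_powr_def powr_double)
  have 2: "(?f has_integral (1 - p) / \<alpha> * Beta (p + 1) (1 - 2 * p) - 1 / \<alpha>) {0..}"
    by (rule has_integral_spike_finite[of "{0}", rotated 2, OF kernel_has_integral_half_line[OF assms]])
      (auto simp: pos_powr_def)
  have "{-1..0} \<inter> {0..} = {0::real}" by auto
  then have "(?f has_integral 1 / \<alpha> + ((1 - p) / \<alpha> * Beta (p + 1) (1 - 2 * p) - 1 / \<alpha>)) ({-1..0} \<union> {0..})"
    by (intro has_integral_Un 1 2) auto
  then have "(?f has_integral (1 - p) / \<alpha> * Beta (p + 1) (1 - 2 * p)) ({-1..0} \<union> {0..})"
    by simp
  then show "(?f has_integral (1 - p) / \<alpha> * Beta (p + 1) (1 - 2 * p)) UNIV"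
    by (rule has_integral_on_superset) (auto simp: pos_powr_def)
qed auto

text \<open>In the expanded Beta value the functional equation of Gamma produces the factor
  \<open>(3 - \<alpha>) / 2\<close>, that is \<open>1 - p\<close>, in the denominator. After this
  cancels, \<open>Gamma_half_reflection\<close> evaluates what is left.\<close>

lemma kernel_constant:
  fixes \<alpha> p :: real
  assumes \<alpha>: "0 < \<alpha>" "\<alpha> < 2" and p: "\<alpha> = 2 * p + 1"
  shows "\<alpha> * sin (\<alpha> * pi / 2) * Gamma \<alpha> * ((1 - p) / \<alpha> * Beta (p + 1) (1 - 2 * p)) =
    (Gamma ((\<alpha> + 1) / 2))\<^sup>2"
proof -
  have 1: "1 - 2 * p = 2 - \<alpha>" "p + 1 = (\<alpha> + 1) / 2" "1 - p = (3 - \<alpha>) / 2" using p by auto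
  have "(3 - \<alpha>) / 2 \<notin> \<int>\<^sub>\<le>\<^sub>0" using \<alpha> by (auto elim!: nonpos_Ints_cases)
  then have 2: "Gamma ((\<alpha> + 1) / 2 + (2 - \<alpha>)) = (3 - \<alpha>) / 2 * Gamma ((3 - \<alpha>) / 2)"
    using Gamma_plus1[of "(3 - \<alpha>) / 2"] by (simp add: field_simps)
  have "Gamma ((3 - \<alpha>) / 2) \<noteq> 0" using \<alpha> by (intro less_imp_neq[symmetric] Gamma_real_pos) auto
  then show ?thesis
    unfolding 1 Beta_def 2 using Gamma_half_reflection[OF \<alpha>] \<alpha>
    by (simp add: divide_simps power2_eq_square) (simp add: mult_ac)
qed

lemma M_half_indicator_increment:
  assumes \<alpha>: "0 < \<alpha>" "\<alpha> < 2"
  shows "(LINT x|lborel. (M_half_indicator \<alpha> t x - M_half_indicator \<alpha> s x)\<^sup>2) = \<bar>t - s\<bar> powr \<alpha>"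
proof (induction s t rule: linorder_wlog)
  case (sym s t)
  then show ?case by (simp add: abs_minus_commute power2_commute)
next
  case (le s t)
  define p where "p = (\<alpha> - 1) / 2"
  have p: "\<alpha> = 2 * p + 1" by (simp add: p_def field_simps)
  define C where "C = sqrt (\<alpha> * sin (\<alpha> * pi / 2) * Gamma \<alpha>) / Gamma ((\<alpha> + 1) / 2)"
  define I where "I = (1 - p) / \<alpha> * Beta (p + 1) (1 - 2 * p)"
  \<comment> \<open>The sine is positive because its argument lies between 0 and \<open>pi\<close>,
    so the radicand in \<open>C\<close> is nonnegative and squaring undoes the root.\<close>
  have CI: "C\<^sup>2 * I = 1"
  proof -
    have "0 < \<alpha> * pi / 2" "\<alpha> * pi / 2 < pi" using \<alpha> by auto
    then have "sin (\<alpha> * pi / 2) > 0" by (rule sin_gt_zero)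
    moreover have "Gamma \<alpha> > 0" using \<alpha> by (intro Gamma_real_pos)
    ultimately have "\<alpha> * sin (\<alpha> * pi / 2) * Gamma \<alpha> \<ge> 0" using \<alpha> by simp
    then have "C\<^sup>2 = \<alpha> * sin (\<alpha> * pi / 2) * Gamma \<alpha> / (Gamma ((\<alpha> + 1) / 2))\<^sup>2"
      by (simp add: C_def power_divide)
    then have "C\<^sup>2 * I = \<alpha> * sin (\<alpha> * pi / 2) * Gamma \<alpha> * I / (Gamma ((\<alpha> + 1) / 2))\<^sup>2"
      by simp
    also have "\<dots> = (Gamma ((\<alpha> + 1) / 2))\<^sup>2 / (Gamma ((\<alpha> + 1) / 2))\<^sup>2"
      unfolding I_def kernel_constant[OF \<alpha> p] ..
    also have "\<dots> = 1"
      using Gamma_real_pos[of "(\<alpha> + 1) / 2"] \<alpha> by (simp add: less_imp_neq[symmetric])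
    finally show ?thesis .
  qed
  have M: "M_half_indicator \<alpha> t x - M_half_indicator \<alpha> s x = C * (pos_powr (t - x) p - pos_powr (s - x) p)" for x
    unfolding M_half_indicator_def C_def[symmetric] p_def[symmetric] by (simp add: algebra_simps)
  show ?case
  proof (cases "s = t")
    case False
    define h where "h = t - s"
    have h: "h > 0" using le False by (simp add: h_def)
    have pp: "pos_powr (h * u) p = h powr p * pos_powr u p" for u
      using h by (simp add: pos_powr_def zero_less_mult_iff powr_mult)
    \<comment> \<open>Substituting \<open>x = s - h * u\<close> turns the two arguments into
      \<open>h * (1 + u)\<close> and \<open>h * u\<close>. Homogeneity of \<open>pos_powr\<close>
      extracts \<open>(h powr p)^2\<close>, which together with the Jacobian \<open>h\<close> makes
      \<open>h powr \<alpha>\<close>.\<close>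
    have "(LINT x|lborel. (C * (pos_powr (t - x) p - pos_powr (s - x) p))\<^sup>2) =
        \<bar>- h\<bar> *\<^sub>R (LINT u|lborel. (C * (pos_powr (t - (s + (- h) * u)) p - pos_powr (s - (s + (- h) * u)) p))\<^sup>2)"
      using h by (intro lborel_integral_real_affine) auto
    also have "(\<lambda>u. (C * (pos_powr (t - (s + (- h) * u)) p - pos_powr (s - (s + (- h) * u)) p))\<^sup>2) =
        (\<lambda>u. (C * h powr p)\<^sup>2 * (pos_powr (1 + u) p - pos_powr u p)\<^sup>2)"
    proof
      fix u
      have "t - (s + (- h) * u) = h * (1 + u)" "s - (s + (- h) * u) = h * u"
        by (simp_all add: h_def algebra_simps)
      then show "(C * (pos_powr (t - (s + (- h) * u)) p - pos_powr (s - (s + (- h) * u)) p))\<^sup>2 =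
          (C * h powr p)\<^sup>2 * (pos_powr (1 + u) p - pos_powr u p)\<^sup>2"
        by (simp only: pp) (simp add: power2_eq_square algebra_simps)
    qed
    also have "\<bar>- h\<bar> *\<^sub>R (LINT u|lborel. (C * h powr p)\<^sup>2 * (pos_powr (1 + u) p - pos_powr u p)\<^sup>2) =
        h * ((C * h powr p)\<^sup>2 * I)"
      using h has_bochner_integral_integral_eq[OF kernel_has_bochner_integral[OF \<alpha> p]]
      by (simp add: I_def)
    also have "\<dots> = h * (h powr p)\<^sup>2 * (C\<^sup>2 * I)" by (simp add: power_mult_distrib)
    also have "\<dots> = h powr \<alpha>" unfolding CI using h
      by (simp add: p powr_add powr_double)
    finally show ?thesis unfolding M using h by (simp add: h_def)
  qed simp
qed

section \<open>L2 limits and the convergence of characteristic functions\<close>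

section \<open>Mean square convergence\<close>

lemma square_integrable_mult:
  assumes "square_integrable M f" "square_integrable M g"
  shows "integrable M (\<lambda>x. f x * g x)"
proof (rule Bochner_Integration.integrable_bound)
  show "integrable M (\<lambda>x. (f x)\<^sup>2 + (g x)\<^sup>2)" 
    using assms by (auto simp: square_integrable_def)
  show "(\<lambda>x. f x * g x) \<in> borel_measurable M" using assms by (auto simp: square_integrable_def)
  have "\<bar>u * v\<bar> \<le> u\<^sup>2 + v\<^sup>2" for u v :: real
  proof -
    have "0 \<le> \<bar>u\<bar> * \<bar>v\<bar>" by simp
    moreover have "2 * (\<bar>u\<bar> * \<bar>v\<bar>) \<le> u\<^sup>2 + v\<^sup>2"
      using sum_squares_bound[of "\<bar>u\<bar>" "\<bar>v\<bar>"] by simp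
    ultimately show ?thesis unfolding abs_mult by linarith
  qed
  then show "AE x in M. norm (f x * g x) \<le> norm ((f x)\<^sup>2 + (g x)\<^sup>2)" by (simp add: abs_of_nonneg)
qed

lemma square_integrable_lincomb:
  assumes "square_integrable M f" "square_integrable M g"
  shows "square_integrable M (\<lambda>x. a * f x + b * g x)"
proof -
  have "integrable M (\<lambda>x. a\<^sup>2 * (f x)\<^sup>2 + b\<^sup>2 * (g x)\<^sup>2 + 2 * a * b * (f x * g x))"
    using assms square_integrable_mult[OF assms] by (auto simp: square_integrable_def)
  moreover have "(a * f x + b * g x)\<^sup>2 = a\<^sup>2 * (f x)\<^sup>2 + b\<^sup>2 * (g x)\<^sup>2 + 2 * a * b * (f x * g x)" for x
    by (simp add: power2_eq_square algebra_simps)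
  ultimately show ?thesis using assms by (auto simp: square_integrable_def)
qed

lemma square_integrable_diff:
  assumes "square_integrable M f" "square_integrable M g"
  shows "square_integrable M (\<lambda>x. f x - g x)"
  using square_integrable_lincomb[OF assms, of 1 "-1"] by simp

text \<open>The gap in \<open>(u + v)^2 \<le> 2 * u^2 + 2 * v^2\<close> is \<open>(u - v)^2\<close>.
  This crude substitute for the Minkowski inequality suffices for null sequences.\<close>

lemma integral_square_lincomb_le:
  assumes "square_integrable M f" "square_integrable M g"
  shows "(LINT x|M. (a * f x + b * g x)\<^sup>2) \<le> 2 * a\<^sup>2 * (LINT x|M. (f x)\<^sup>2) + 2 * b\<^sup>2 * (LINT x|M. (g x)\<^sup>2)"
proof -
  have "(LINT x|M. (a * f x + b * g x)\<^sup>2) \<le> (LINT x|M. 2 * a\<^sup>2 * (f x)\<^sup>2 + 2 * b\<^sup>2 * (g x)\<^sup>2)"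
  proof (rule integral_mono)
    show "(a * f x + b * g x)\<^sup>2 \<le> 2 * a\<^sup>2 * (f x)\<^sup>2 + 2 * b\<^sup>2 * (g x)\<^sup>2" for x
      using zero_le_power2[of "a * f x - b * g x"] by (simp add: power2_eq_square algebra_simps)
  qed (use assms square_integrable_lincomb[OF assms, of a b] in \<open>auto simp: square_integrable_def\<close>)
  also have "\<dots> = 2 * a\<^sup>2 * (LINT x|M. (f x)\<^sup>2) + 2 * b\<^sup>2 * (LINT x|M. (g x)\<^sup>2)"
    using assms by (subst Bochner_Integration.integral_add) (auto simp: square_integrable_def)
  finally show ?thesis .
qed

lemma tendsto_integral_square_lincomb:
  assumes "\<And>n. square_integrable M (f n)" "\<And>n. square_integrable M (g n)"
    and f: "(\<lambda>n. LINT x|M. (f n x)\<^sup>2) \<longlonglongrightarrow> 0" and g: "(\<lambda>n. LINT x|M. (g n x)\<^sup>2) \<longlonglongrightarrow> 0"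
  shows "(\<lambda>n. LINT x|M. (a * f n x + b * g n x)\<^sup>2) \<longlonglongrightarrow> 0"
proof (rule tendsto_sandwich[OF _ _ tendsto_const])
  show "\<forall>\<^sub>F n in sequentially. (LINT x|M. (a * f n x + b * g n x)\<^sup>2)
      \<le> 2 * a\<^sup>2 * (LINT x|M. (f n x)\<^sup>2) + 2 * b\<^sup>2 * (LINT x|M. (g n x)\<^sup>2)"
    using assms by (intro always_eventually allI integral_square_lincomb_le)
  show "(\<lambda>n. 2 * a\<^sup>2 * (LINT x|M. (f n x)\<^sup>2) + 2 * b\<^sup>2 * (LINT x|M. (g n x)\<^sup>2)) \<longlonglongrightarrow> 0"
    using tendsto_add[OF tendsto_mult_left[OF f] tendsto_mult_left[OF g]] by simp
qed simp

text \<open>Convergence of \<open>f n\<close> to \<open>h\<close> in \<open>L\<^sup>2\<close> is weighed against the fixed \<open>h\<close> by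
  \<open>2uv \<le> e u\<^sup>2 + v\<^sup>2 / e\<close>, which replaces the Cauchy-Schwarz inequality.\<close>

lemma tendsto_integral_square:
  assumes sf: "\<And>n. square_integrable M (f n)" and sh: "square_integrable M h"
    and lim: "(\<lambda>n. LINT x|M. (f n x - h x)\<^sup>2) \<longlonglongrightarrow> 0"
  shows "(\<lambda>n. LINT x|M. (f n x)\<^sup>2) \<longlonglongrightarrow> (LINT x|M. (h x)\<^sup>2)"
proof (rule LIMSEQ_I)
  fix r :: real assume r: "r > 0"
  define A where "A = (LINT x|M. (h x)\<^sup>2)"
  define D where "D = (\<lambda>n. LINT x|M. (f n x - h x)\<^sup>2)"
  have A: "A \<ge> 0" unfolding A_def by simp
  \<comment> \<open>The bound below tends to \<open>e * A\<close>; this choice keeps that limit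
    below \<open>r\<close>, and the summand 1 covers \<open>A = 0\<close>.\<close>
  define e where "e = r / (2 * (A + 1))"
  have e: "e > 0" using r A by (simp add: e_def)
  have bound: "\<bar>(LINT x|M. (f n x)\<^sup>2) - A\<bar> \<le> e * A + (1 + 1 / e) * D n" for n
  proof -
    have sd: "square_integrable M (\<lambda>x. f n x - h x)" by (intro square_integrable_diff sf sh)
    have ptw: "\<bar>(f n x)\<^sup>2 - (h x)\<^sup>2\<bar> \<le> e * (h x)\<^sup>2 + (1 + 1 / e) * (f n x - h x)\<^sup>2" for x
    proof -
      define u v where "u = h x" and "v = f n x - h x"
      have "2 * \<bar>u * v\<bar> \<le> e * u\<^sup>2 + 1 / e * v\<^sup>2"
      proof -
        have "0 \<le> (e * \<bar>u\<bar> - \<bar>v\<bar>)\<^sup>2 / e" using e by simp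
        also have "\<dots> = e * u\<^sup>2 + 1 / e * v\<^sup>2 - 2 * \<bar>u * v\<bar>"
          using e by (simp add: power2_diff power_mult_distrib abs_mult field_simps) (simp add: power2_eq_square)
        finally show ?thesis by simp
      qed
      moreover have "(f n x)\<^sup>2 - (h x)\<^sup>2 = v\<^sup>2 + 2 * (u * v)"
        by (simp add: u_def v_def power2_eq_square algebra_simps)
      moreover have "\<bar>v\<^sup>2 + 2 * (u * v)\<bar> \<le> v\<^sup>2 + 2 * \<bar>u * v\<bar>"
        using abs_triangle_ineq[of "v\<^sup>2" "2 * (u * v)"] by (simp add: abs_mult)
      ultimately have "\<bar>(f n x)\<^sup>2 - (h x)\<^sup>2\<bar> \<le> e * u\<^sup>2 + (v\<^sup>2 + 1 / e * v\<^sup>2)" by linarith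
      then show ?thesis by (simp add: u_def v_def distrib_right)
    qed
    have "\<bar>(LINT x|M. (f n x)\<^sup>2) - A\<bar> = \<bar>LINT x|M. (f n x)\<^sup>2 - (h x)\<^sup>2\<bar>"
      unfolding A_def using sf[of n] sh by (subst Bochner_Integration.integral_diff) (auto simp: square_integrable_def)
    also have "\<dots> \<le> (LINT x|M. \<bar>(f n x)\<^sup>2 - (h x)\<^sup>2\<bar>)" by (rule integral_abs_bound)
    also have "\<dots> \<le> (LINT x|M. e * (h x)\<^sup>2 + (1 + 1 / e) * (f n x - h x)\<^sup>2)"
      using sf[of n] sh sd by (intro integral_mono ptw) (auto simp: square_integrable_def)
    also have "\<dots> = e * A + (1 + 1 / e) * D n"
      unfolding A_def D_def using sh sd
      by (subst Bochner_Integration.integral_add) (auto simp: square_integrable_def)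
    finally show ?thesis .
  qed
  have "(\<lambda>n. e * A + (1 + 1 / e) * D n) \<longlonglongrightarrow> e * A + (1 + 1 / e) * 0"
    unfolding D_def by (intro tendsto_intros lim)
  moreover have "e * A + (1 + 1 / e) * 0 < r"
    using r A by (simp add: e_def field_simps) (smt (verit) mult_nonneg_nonneg)
  ultimately have "\<forall>\<^sub>F n in sequentially. e * A + (1 + 1 / e) * D n < r"
    by (rule order_tendstoD(2))
  then obtain N where "\<And>n. n \<ge> N \<Longrightarrow> e * A + (1 + 1 / e) * D n < r"
    unfolding eventually_sequentially by blast
  then show "\<exists>N. \<forall>n\<ge>N. norm ((LINT x|M. (f n x)\<^sup>2) - (LINT x|M. (h x)\<^sup>2)) < r"
    using bound unfolding A_def real_norm_def by (meson le_less_trans)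
qed

text \<open>Nonnegativity of the variance of \<open>\<bar>Y n\<bar>\<close> bounds its mean by the
  root of its second moment.\<close>

lemma (in prob_space) tendsto_integral_abs:
  assumes sq: "\<And>n. square_integrable M (Y n)" and lim: "(\<lambda>n. expectation (\<lambda>w. (Y n w)\<^sup>2)) \<longlonglongrightarrow> 0"
  shows "(\<lambda>n. expectation (\<lambda>w. \<bar>Y n w\<bar>)) \<longlonglongrightarrow> 0"
proof (rule tendsto_sandwich[OF _ _ tendsto_const])
  show "\<forall>\<^sub>F n in sequentially. expectation (\<lambda>w. \<bar>Y n w\<bar>) \<le> sqrt (expectation (\<lambda>w. (Y n w)\<^sup>2))"
  proof (intro always_eventually allI)
    fix n
    have s: "integrable M (\<lambda>w. (Y n w)\<^sup>2)" and m: "Y n \<in> borel_measurable M"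
      using sq[of n] by (auto simp: square_integrable_def)
    have i: "integrable M (\<lambda>w. \<bar>Y n w\<bar>)"
      using square_integrable_imp_integrable[OF m s] by simp
    have "0 \<le> variance (\<lambda>w. \<bar>Y n w\<bar>)" by (rule variance_positive)
    also have "\<dots> = expectation (\<lambda>w. (Y n w)\<^sup>2) - (expectation (\<lambda>w. \<bar>Y n w\<bar>))\<^sup>2"
      using i s by (subst variance_eq) simp_all
    finally show "expectation (\<lambda>w. \<bar>Y n w\<bar>) \<le> sqrt (expectation (\<lambda>w. (Y n w)\<^sup>2))"
      by (intro real_le_rsqrt) simp
  qed
  show "(\<lambda>n. sqrt (expectation (\<lambda>w. (Y n w)\<^sup>2))) \<longlonglongrightarrow> 0"
    using tendsto_real_sqrt[OF lim] by simp
qed simp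

lemma norm_exp_i_diff_le: "norm (exp (\<i> * complex_of_real u) - exp (\<i> * complex_of_real v)) \<le> \<bar>u - v\<bar>"
proof -
  have "exp (\<i> * complex_of_real u) - exp (\<i> * complex_of_real v) =
      exp (\<i> * complex_of_real v) * (exp (\<i> * complex_of_real (u - v)) - 1)"
    by (simp add: algebra_simps flip: exp_add)
  then have "norm (exp (\<i> * complex_of_real u) - exp (\<i> * complex_of_real v)) = norm (exp (\<i> * complex_of_real (u - v)) - 1)"
    by (simp add: norm_mult)
  also have "\<dots> \<le> \<bar>u - v\<bar>"
    using iexp_approx1[of "u - v" 0] by simp
  finally show ?thesis .
qed

text \<open>The map \<open>u\<close> to \<open>exp (\<i> * u)\<close> is 1-Lipschitz on the reals,
  so the two characteristic values differ by at most the mean of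
  \<open>\<bar>Y n - X\<bar>\<close>.\<close>

lemma (in prob_space) tendsto_char:
  assumes sY: "\<And>n. square_integrable M (Y n)" and sX: "square_integrable M X"
    and lim: "(\<lambda>n. expectation (\<lambda>w. (Y n w - X w)\<^sup>2)) \<longlonglongrightarrow> 0"
  shows "(\<lambda>n. LINT w|M. exp (\<i> * complex_of_real (Y n w))) \<longlonglongrightarrow> (LINT w|M. exp (\<i> * complex_of_real (X w)))"
proof (rule LIM_zero_cancel, rule Lim_null_comparison)
  have [measurable]: "Y n \<in> borel_measurable M" "X \<in> borel_measurable M" for n
    using sX sY[of n] by (auto simp: square_integrable_def)
  have sd: "square_integrable M (\<lambda>w. Y n w - X w)" for n by (intro square_integrable_diff sX sY)
  show "(\<lambda>n. expectation (\<lambda>w. \<bar>Y n w - X w\<bar>)) \<longlonglongrightarrow> 0"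
    by (intro tendsto_integral_abs sd lim)
  have int: "integrable M (\<lambda>w. exp (\<i> * complex_of_real (Z w)))" if [measurable]: "Z \<in> borel_measurable M" for Z
    by (intro integrable_const_bound[of _ 1]) auto
  show "\<forall>\<^sub>F n in sequentially. norm ((LINT w|M. exp (\<i> * complex_of_real (Y n w))) -
      (LINT w|M. exp (\<i> * complex_of_real (X w)))) \<le> expectation (\<lambda>w. \<bar>Y n w - X w\<bar>)"
  proof (intro always_eventually allI)
    fix n
    have i: "integrable M (\<lambda>w. Y n w - X w)"
      using sd[of n] unfolding square_integrable_def by (elim conjE) (rule square_integrable_imp_integrable)
    have "norm ((LINT w|M. exp (\<i> * complex_of_real (Y n w))) - (LINT w|M. exp (\<i> * complex_of_real (X w)))) =
        norm (LINT w|M. exp (\<i> * complex_of_real (Y n w)) - exp (\<i> * complex_of_real (X w)))"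
      by (subst Bochner_Integration.integral_diff) (auto intro!: int)
    also have "\<dots> \<le> (LINT w|M. norm (exp (\<i> * complex_of_real (Y n w)) - exp (\<i> * complex_of_real (X w))))"
      by (rule integral_norm_bound)
    also have "\<dots> \<le> expectation (\<lambda>w. \<bar>Y n w - X w\<bar>)"
      using i by (intro integral_mono norm_exp_i_diff_le)
        (auto intro!: int integrable_norm Bochner_Integration.integrable_diff)
    finally show "norm ((LINT w|M. exp (\<i> * complex_of_real (Y n w))) - (LINT w|M. exp (\<i> * complex_of_real (X w))))
        \<le> expectation (\<lambda>w. \<bar>Y n w - X w\<bar>)" .
  qed
qed

section \<open>Linearity and characteristic function of the extended pairing\<close>

section \<open>Schwartz functions and the extended pairing\<close>

lemma schwartz_DERIV:
  assumes "f \<in> schwartz"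
  shows "((deriv ^^ k) f has_real_derivative (deriv ^^ Suc k) f x) (at x)"
  using assms by (simp add: schwartz_def DERIV_deriv_iff_real_differentiable)

lemma higher_deriv_lincomb:
  assumes f: "f \<in> schwartz" and g: "g \<in> schwartz"
  shows "(deriv ^^ k) (\<lambda>x. a * f x + b * g x) = (\<lambda>x. a * (deriv ^^ k) f x + b * (deriv ^^ k) g x)"
proof (induction k)
  case (Suc k)
  have "deriv (\<lambda>x. a * (deriv ^^ k) f x + b * (deriv ^^ k) g x) x =
      a * (deriv ^^ Suc k) f x + b * (deriv ^^ Suc k) g x" for x
    by (intro DERIV_imp_deriv DERIV_add DERIV_cmult schwartz_DERIV f g)
  with Suc show ?case by auto
qed simp

lemma schwartz_bound:
  assumes "f \<in> schwartz"
  obtains C where "\<And>x. \<bar>x ^ m * (deriv ^^ k) f x\<bar> \<le> C"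
proof -
  have "bounded (range (\<lambda>x. x ^ m * (deriv ^^ k) f x))" using assms by (simp add: schwartz_def)
  then show ?thesis using that unfolding bounded_iff by auto
qed

lemma schwartz_lincomb:
  assumes f: "f \<in> schwartz" and g: "g \<in> schwartz"
  shows "(\<lambda>x. a * f x + b * g x) \<in> schwartz"
  unfolding schwartz_def mem_Collect_eq higher_deriv_lincomb[OF f g]
proof (intro conjI allI)
  fix k :: nat and x :: real
  have "((\<lambda>x. a * (deriv ^^ k) f x + b * (deriv ^^ k) g x) has_real_derivative
      a * (deriv ^^ Suc k) f x + b * (deriv ^^ Suc k) g x) (at x)"
    by (intro DERIV_add DERIV_cmult schwartz_DERIV f g)
  then show "(\<lambda>x. a * (deriv ^^ k) f x + b * (deriv ^^ k) g x) differentiable at x"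
    using real_differentiable_def by blast
next
  fix m k :: nat
  obtain C D where C: "\<And>x. \<bar>x ^ m * (deriv ^^ k) f x\<bar> \<le> C" and D: "\<And>x. \<bar>x ^ m * (deriv ^^ k) g x\<bar> \<le> D"
    using schwartz_bound[OF f] schwartz_bound[OF g] by metis
  have "\<bar>x ^ m * (a * (deriv ^^ k) f x + b * (deriv ^^ k) g x)\<bar> \<le> \<bar>a\<bar> * C + \<bar>b\<bar> * D" for x
  proof -
    have "\<bar>x ^ m * (a * (deriv ^^ k) f x + b * (deriv ^^ k) g x)\<bar> =
        \<bar>a * (x ^ m * (deriv ^^ k) f x) + b * (x ^ m * (deriv ^^ k) g x)\<bar>"
      by (simp add: algebra_simps)
    also have "\<dots> \<le> \<bar>a\<bar> * \<bar>x ^ m * (deriv ^^ k) f x\<bar> + \<bar>b\<bar> * \<bar>x ^ m * (deriv ^^ k) g x\<bar>"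
      unfolding abs_mult[symmetric] by (rule abs_triangle_ineq)
    also have "\<dots> \<le> \<bar>a\<bar> * C + \<bar>b\<bar> * D"
      by (intro add_mono mult_left_mono C D) auto
    finally show ?thesis .
  qed
  then show "bounded (range (\<lambda>x. x ^ m * (a * (deriv ^^ k) f x + b * (deriv ^^ k) g x)))"
    unfolding bounded_iff by auto
qed

lemma integrable_inverse_1_plus_square_UNIV: "integrable lborel (\<lambda>x::real. inverse (1 + x\<^sup>2))"
  using integrable_inverse_1_plus_square by (simp add: set_integrable_def einterval_eq_UNIV)

text \<open>Bounds \<open>C\<close> for \<open>f\<close> and \<open>D\<close> for
  \<open>x * f x\<close> add up to \<open>(f x)^2 * (1 + x^2) \<le> C^2 + D^2\<close>, so the square
  is dominated by the Cauchy density up to a factor.\<close>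

lemma schwartz_square_integrable:
  assumes f: "f \<in> schwartz"
  shows "square_integrable lborel f"
proof -
  have "isCont f x" for x using schwartz_DERIV[OF f, of 0 x] by (auto intro: DERIV_isCont)
  then have m[measurable]: "f \<in> borel_measurable borel"
    by (intro borel_measurable_continuous_onI) (simp add: continuous_at_imp_continuous_on)
  obtain C where C: "\<And>x. \<bar>f x\<bar> \<le> C" using schwartz_bound[OF f, of 0 0] by auto
  obtain D where D: "\<And>x. \<bar>x * f x\<bar> \<le> D" using schwartz_bound[OF f, of 1 0] by auto
  have "integrable lborel (\<lambda>x. (f x)\<^sup>2)"
  proof (rule Bochner_Integration.integrable_bound)
    show "integrable lborel (\<lambda>x::real. (C\<^sup>2 + D\<^sup>2) * inverse (1 + x\<^sup>2))"
      by (intro integrable_mult_right integrable_inverse_1_plus_square_UNIV)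
    have "(f x)\<^sup>2 \<le> (C\<^sup>2 + D\<^sup>2) * inverse (1 + x\<^sup>2)" for x
    proof -
      have "(f x)\<^sup>2 \<le> C\<^sup>2" "(x * f x)\<^sup>2 \<le> D\<^sup>2" using C[of x] D[of x] by (auto intro: power2_le_iff_abs_le[THEN iffD2] simp: abs_le_square_iff)
      then have "(f x)\<^sup>2 * (1 + x\<^sup>2) \<le> C\<^sup>2 + D\<^sup>2" by (simp add: power_mult_distrib algebra_simps)
      moreover have "1 + x\<^sup>2 > 0" by (simp add: add_pos_nonneg)
      ultimately show ?thesis by (simp add: field_simps)
    qed
    then show "AE x in lborel. norm ((f x)\<^sup>2) \<le> norm ((C\<^sup>2 + D\<^sup>2) * inverse (1 + x\<^sup>2))"
      by (simp add: abs_of_nonneg)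
  qed simp
  then show ?thesis by (simp add: square_integrable_def)
qed

text \<open>The components have literally the shape in which \<open>tempered_distributions\<close>
  states linearity, so that clause applies slot by slot.\<close>

definition vec_lincomb :: "real \<Rightarrow> (real \<Rightarrow> real) ^ 'd \<Rightarrow> real \<Rightarrow> (real \<Rightarrow> real) ^ 'd \<Rightarrow> (real \<Rightarrow> real) ^ 'd" where
  "vec_lincomb a \<phi> b \<psi> = (\<chi> i. (\<lambda>x. a * (\<phi> $ i) x + b * (\<psi> $ i) x))"

lemma schwartz_vec_lincomb:
  "\<phi> \<in> schwartz_vec \<Longrightarrow> \<psi> \<in> schwartz_vec \<Longrightarrow> vec_lincomb a \<phi> b \<psi> \<in> schwartz_vec"
  by (simp add: schwartz_vec_def vec_lincomb_def schwartz_lincomb)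

lemma pairing0_lincomb:
  assumes "w \<in> tempered_vec" "\<phi> \<in> schwartz_vec" "\<psi> \<in> schwartz_vec"
  shows "pairing0 w (vec_lincomb a \<phi> b \<psi>) = a * pairing0 w \<phi> + b * pairing0 w \<psi>"
proof -
  have "(w $ j) (\<lambda>x. a * (\<phi> $ j) x + b * (\<psi> $ j) x) = a * (w $ j) (\<phi> $ j) + b * (w $ j) (\<psi> $ j)" for j
    using assms by (simp add: tempered_vec_def schwartz_vec_def tempered_distributions_def)
  then show ?thesis
    by (simp add: pairing0_def vec_lincomb_def sum.distrib sum_distrib_left)
qed

text \<open>A finite sum of nonnegative terms tends to 0 exactly if each term does; this reduces
  vector-valued convergence to the scalar L2 lemmas.\<close>

lemma norm0_sq_tendsto_0_iff:
  "(\<lambda>n. norm0_sq (\<phi> n)) \<longlonglongrightarrow> 0 \<longleftrightarrow> (\<forall>j. (\<lambda>n. LINT x|lborel. ((\<phi> n $ j) x)\<^sup>2) \<longlonglongrightarrow> 0)"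
proof (intro iffI allI)
  fix j assume lim: "(\<lambda>n. norm0_sq (\<phi> n)) \<longlonglongrightarrow> 0"
  show "(\<lambda>n. LINT x|lborel. ((\<phi> n $ j) x)\<^sup>2) \<longlonglongrightarrow> 0"
  proof (rule tendsto_sandwich[OF _ _ tendsto_const lim])
    show "\<forall>\<^sub>F n in sequentially. (LINT x|lborel. ((\<phi> n $ j) x)\<^sup>2) \<le> norm0_sq (\<phi> n)"
      unfolding norm0_sq_def by (intro always_eventually allI member_le_sum) auto
  qed simp
next
  assume "\<forall>j. (\<lambda>n. LINT x|lborel. ((\<phi> n $ j) x)\<^sup>2) \<longlonglongrightarrow> 0"
  then show "(\<lambda>n. norm0_sq (\<phi> n)) \<longlonglongrightarrow> 0" unfolding norm0_sq_def by (intro tendsto_null_sum) auto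
qed

text \<open>The same linear combination of two approximating sequences approximates the combined
  target, both in the space of test functions and in L2 of \<open>M\<close>.\<close>

lemma extended_pairing_lincomb:
  assumes sp: "space M = tempered_vec"
    and X: "extended_pairing M \<eta> X" and Y: "extended_pairing M \<zeta> Y"
  shows "extended_pairing M (vec_lincomb a \<eta> b \<zeta>) (\<lambda>w. a * X w + b * Y w)"
proof -
  obtain \<phi> where \<phi>: "\<And>k. \<phi> k \<in> schwartz_vec" "\<And>k. square_integrable M (\<lambda>w. pairing0 w (\<phi> k))"
    "(\<lambda>k. norm0_sq (\<chi> j. (\<lambda>x. (\<phi> k $ j) x - (\<eta> $ j) x))) \<longlonglongrightarrow> 0"
    "(\<lambda>k. LINT w|M. (pairing0 w (\<phi> k) - X w)\<^sup>2) \<longlonglongrightarrow> 0"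
    using X unfolding extended_pairing_def by blast
  obtain \<psi> where \<psi>: "\<And>k. \<psi> k \<in> schwartz_vec" "\<And>k. square_integrable M (\<lambda>w. pairing0 w (\<psi> k))"
    "(\<lambda>k. norm0_sq (\<chi> j. (\<lambda>x. (\<psi> k $ j) x - (\<zeta> $ j) x))) \<longlonglongrightarrow> 0"
    "(\<lambda>k. LINT w|M. (pairing0 w (\<psi> k) - Y w)\<^sup>2) \<longlonglongrightarrow> 0"
    using Y unfolding extended_pairing_def by blast
  have sX: "square_integrable M X" and s\<eta>: "\<And>j. square_integrable lborel (\<eta> $ j)"
    using X by (auto simp: extended_pairing_def)
  have sY: "square_integrable M Y" and s\<zeta>: "\<And>j. square_integrable lborel (\<zeta> $ j)"
    using Y by (auto simp: extended_pairing_def)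
  have s\<phi>: "square_integrable lborel (\<phi> k $ j)" and s\<psi>: "square_integrable lborel (\<psi> k $ j)" for k j
    using \<phi>(1) \<psi>(1) by (auto simp: schwartz_vec_def intro: schwartz_square_integrable)
  define \<theta> where "\<theta> = (\<lambda>k. vec_lincomb a (\<phi> k) b (\<psi> k))"
  \<comment> \<open>Linearity of the pairing is known for tempered \<open>w\<close> only, hence the
    passage through \<open>space M\<close> and the congruence rules used below.\<close>
  have pair: "pairing0 w (\<theta> k) = a * pairing0 w (\<phi> k) + b * pairing0 w (\<psi> k)" if "w \<in> space M" for w k
    using that unfolding sp \<theta>_def by (intro pairing0_lincomb \<phi> \<psi>)
  show ?thesis unfolding extended_pairing_def
  proof (intro conjI allI exI[of _ \<theta>])
    show "square_integrable lborel (vec_lincomb a \<eta> b \<zeta> $ j)" for j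
      using square_integrable_lincomb[OF s\<eta> s\<zeta>] by (simp add: vec_lincomb_def)
    show "square_integrable M (\<lambda>w. a * X w + b * Y w)" by (intro square_integrable_lincomb sX sY)
    show "\<theta> k \<in> schwartz_vec" for k unfolding \<theta>_def by (intro schwartz_vec_lincomb \<phi> \<psi>)
    show "square_integrable M (\<lambda>w. pairing0 w (\<theta> k))" for k
    proof -
      have "square_integrable M (\<lambda>w. pairing0 w (\<theta> k)) \<longleftrightarrow>
          square_integrable M (\<lambda>w. a * pairing0 w (\<phi> k) + b * pairing0 w (\<psi> k))"
        unfolding square_integrable_def
        by (intro arg_cong2[where f = "(\<and>)"] measurable_cong Bochner_Integration.integrable_cong) (auto simp: pair)
      then show ?thesis using square_integrable_lincomb[OF \<phi>(2) \<psi>(2)] by simp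
    qed
    show "(\<lambda>k. norm0_sq (\<chi> j. (\<lambda>x. (\<theta> k $ j) x - (vec_lincomb a \<eta> b \<zeta> $ j) x))) \<longlonglongrightarrow> 0"
      unfolding norm0_sq_tendsto_0_iff
    proof
      fix j
      have "(\<lambda>k. LINT x|lborel. (a * ((\<phi> k $ j) x - (\<eta> $ j) x) + b * ((\<psi> k $ j) x - (\<zeta> $ j) x))\<^sup>2) \<longlonglongrightarrow> 0"
        using \<phi>(3) \<psi>(3) unfolding norm0_sq_tendsto_0_iff
        by (intro tendsto_integral_square_lincomb square_integrable_diff s\<phi> s\<psi> s\<eta> s\<zeta>) auto
      moreover have "a * ((\<phi> k $ j) x - (\<eta> $ j) x) + b * ((\<psi> k $ j) x - (\<zeta> $ j) x) =
          (\<theta> k $ j) x - (vec_lincomb a \<eta> b \<zeta> $ j) x" for k x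
        by (simp add: \<theta>_def vec_lincomb_def algebra_simps)
      ultimately show "(\<lambda>k. LINT x|lborel. (((\<chi> j. (\<lambda>x. (\<theta> k $ j) x - (vec_lincomb a \<eta> b \<zeta> $ j) x)) $ j) x)\<^sup>2) \<longlonglongrightarrow> 0"
        by simp
    qed
    have "(\<lambda>k. LINT w|M. (a * (pairing0 w (\<phi> k) - X w) + b * (pairing0 w (\<psi> k) - Y w))\<^sup>2) \<longlonglongrightarrow> 0"
      by (intro tendsto_integral_square_lincomb square_integrable_diff \<phi> \<psi> sX sY)
    moreover have "(LINT w|M. (a * (pairing0 w (\<phi> k) - X w) + b * (pairing0 w (\<psi> k) - Y w))\<^sup>2) =
        (LINT w|M. (pairing0 w (\<theta> k) - (a * X w + b * Y w))\<^sup>2)" for k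
      by (intro Bochner_Integration.integral_cong) (auto simp: pair algebra_simps)
    ultimately show "(\<lambda>k. LINT w|M. (pairing0 w (\<theta> k) - (a * X w + b * Y w))\<^sup>2) \<longlonglongrightarrow> 0" by simp
  qed
qed

lemma extended_pairing_sum:
  assumes sp: "space M = tempered_vec" and "finite I" "I \<noteq> {}"
    and X: "\<And>i. i \<in> I \<Longrightarrow> extended_pairing M (\<eta> i) (X i)"
  shows "extended_pairing M (\<chi> j. (\<lambda>x. \<Sum>i\<in>I. c i * (\<eta> i $ j) x)) (\<lambda>w. \<Sum>i\<in>I. c i * X i w)"
  using assms(2-4)
proof (induction I rule: finite_ne_induct)
  \<comment> \<open>A scalar multiple is obtained by combining the pairing with itself, with second
    coefficient 0.\<close>
  case (singleton i)
  then show ?case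
    using extended_pairing_lincomb[OF sp singleton[OF singletonI] singleton[OF singletonI], of "c i" 0]
    by (simp add: vec_lincomb_def)
next
  case (insert i I)
  then show ?case
    using extended_pairing_lincomb[OF sp insert(5)[OF insertI1] insert(4), of "c i" 1]
    by (simp add: vec_lincomb_def)
qed

lemma norm0_sq_tendsto:
  assumes "\<And>k j. square_integrable lborel (\<phi> k $ j)" "\<And>j. square_integrable lborel (\<eta> $ j)"
    and "(\<lambda>k. norm0_sq (\<chi> j. (\<lambda>x. (\<phi> k $ j) x - (\<eta> $ j) x))) \<longlonglongrightarrow> 0"
  shows "(\<lambda>k. norm0_sq (\<phi> k)) \<longlonglongrightarrow> norm0_sq \<eta>"
  using assms(3) unfolding norm0_sq_def[of "\<phi> _"] norm0_sq_def[of \<eta>] norm0_sq_tendsto_0_iff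
  by (intro tendsto_sum tendsto_integral_square assms(1,2)) simp

text \<open>Both sides of the defining formula pass to the limit along the approximants: the left by
  \<open>tendsto_char\<close>, the right by convergence of the norms and continuity of the
  Mittag-Leffler function.\<close>

lemma char_extended_pairing:
  assumes \<beta>: "0 < \<beta>" and M: "mittag_leffler_measure \<beta> M" and X: "extended_pairing M \<eta> X"
  shows "(LINT w|M. exp (\<i> * complex_of_real (X w))) = mittag_leffler \<beta> (complex_of_real (- norm0_sq \<eta> / 2))"
proof -
  interpret prob_space M using M by (simp add: mittag_leffler_measure_def)
  obtain \<phi> where \<phi>: "\<And>k. \<phi> k \<in> schwartz_vec" "\<And>k. square_integrable M (\<lambda>w. pairing0 w (\<phi> k))"
    "(\<lambda>k. norm0_sq (\<chi> j. (\<lambda>x. (\<phi> k $ j) x - (\<eta> $ j) x))) \<longlonglongrightarrow> 0"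
    "(\<lambda>k. LINT w|M. (pairing0 w (\<phi> k) - X w)\<^sup>2) \<longlonglongrightarrow> 0"
    using X unfolding extended_pairing_def by blast
  have sX: "square_integrable M X" and s\<eta>: "\<And>j. square_integrable lborel (\<eta> $ j)"
    using X by (auto simp: extended_pairing_def)
  have s\<phi>: "square_integrable lborel (\<phi> k $ j)" for k j
    using \<phi>(1) by (auto simp: schwartz_vec_def intro: schwartz_square_integrable)
  have "(\<lambda>k. LINT w|M. exp (\<i> * complex_of_real (pairing0 w (\<phi> k)))) \<longlonglongrightarrow>
      (LINT w|M. exp (\<i> * complex_of_real (X w)))"
    by (intro tendsto_char \<phi> sX)
  moreover have "(LINT w|M. exp (\<i> * complex_of_real (pairing0 w (\<phi> k)))) =
      mittag_leffler \<beta> (complex_of_real (- norm0_sq (\<phi> k) / 2))" for k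
    using M \<phi>(1) by (simp add: mittag_leffler_measure_def)
  moreover have "(\<lambda>k. mittag_leffler \<beta> (complex_of_real (- norm0_sq (\<phi> k) / 2))) \<longlonglongrightarrow>
      mittag_leffler \<beta> (complex_of_real (- norm0_sq \<eta> / 2))"
    by (intro isCont_tendsto_compose[OF isCont_mittag_leffler[OF \<beta>]] tendsto_of_real tendsto_divide
        tendsto_minus tendsto_const norm0_sq_tendsto s\<phi> s\<eta> \<phi>) simp
  ultimately show ?thesis using LIMSEQ_unique by simp
qed

section \<open>Double integral of the Mittag-Leffler series\<close>

section \<open>Termwise integration\<close>

text \<open>The majorant \<open>K\<close> bounds the L1 norm of term \<open>j\<close> by
  \<open>K j * (b - a)\<close>, so the sum of the norms converges and sum and integral may be
  exchanged.\<close>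

lemma set_integral_suminf_Icc:
  fixes f :: "nat \<Rightarrow> real \<Rightarrow> real"
  assumes cont: "\<And>j. continuous_on {a..b} (f j)"
    and bound: "\<And>j x. x \<in> {a..b} \<Longrightarrow> \<bar>f j x\<bar> \<le> K j" and K: "summable K"
  shows "(LINT x:{a..b}|lborel. \<Sum>j. f j x) = (\<Sum>j. LINT x:{a..b}|lborel. f j x)"
proof (cases "a \<le> b")
  case ab: True
  have K0: "0 \<le> K j" for j using bound[of a j] ab by auto
  define g where "g = (\<lambda>j x. indicator {a..b} x *\<^sub>R f j x)"
  have gi: "integrable lborel (g j)" for j
    using borel_integrable_atLeastAtMost'[OF cont[of j]] by (simp add: g_def set_integrable_def)
  have gb: "norm (g j x) \<le> K j * indicator {a..b} x" for j x
    using bound[of x j] by (auto simp: g_def indicator_def)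
  have gb': "norm (g j x) \<le> K j" for j x
    using bound[of x j] K0[of j] by (auto simp: g_def indicator_def)
  have "(\<integral>x. norm (g j x) \<partial>lborel) \<le> K j * (b - a)" for j
  proof -
    have "(\<integral>x. norm (g j x) \<partial>lborel) \<le> (\<integral>x. K j * indicator {a..b} x \<partial>lborel)"
      using gb gi borel_integrable_atLeastAtMost'[of a b "\<lambda>_. 1 :: real"]
      by (intro integral_mono) (auto simp: set_integrable_def)
    then show ?thesis using ab by simp
  qed
  then have "summable (\<lambda>j. \<integral>x. norm (g j x) \<partial>lborel)"
    by (intro summable_comparison_test'[OF summable_mult2[OF K, of "b - a"], of 0]) auto
  moreover have s: "summable (\<lambda>j. norm (g j x))" for x
    using gb' by (intro summable_comparison_test'[OF K, of 0]) auto
  ultimately have "(\<integral>x. (\<Sum>j. g j x) \<partial>lborel) = (\<Sum>j. integral\<^sup>L lborel (g j))"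
    by (intro integral_suminf gi AE_I2)
  moreover have "(\<Sum>j. g j x) = indicator {a..b} x *\<^sub>R (\<Sum>j. f j x)" for x
    by (auto simp: g_def indicator_def)
  ultimately show ?thesis by (simp add: set_lebesgue_integral_def g_def)
qed (simp add: set_lebesgue_integral_def)

lemma continuous_on_abs_diff_powr_power:
  assumes "0 < (\<alpha>::real)"
  shows "continuous_on S (\<lambda>s. (\<bar>t - s\<bar> powr \<alpha>) ^ j)"
  using assms by (intro continuous_on_power continuous_on_powr' continuous_intros) auto

text \<open>Positivity matters at \<open>j = 0\<close>: for \<open>x = 0\<close> the left side is 1,
  but \<open>0 powr 0\<close> is 0. The integrands therefore keep the form of a natural power, which
  is continuous across the diagonal, and are rewritten only off it.\<close>

lemma powr_power_nat: "0 < (x::real) \<Longrightarrow> (x powr \<alpha>) ^ j = x powr (\<alpha> * real j)"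
  by (simp add: powr_powr flip: powr_realpow)

text \<open>The interval is split at \<open>s = t\<close>, where the sign of \<open>t - s\<close>
  changes, and each half has an elementary antiderivative.\<close>

lemma set_integral_abs_diff_powr_power:
  fixes t T \<alpha> :: real and j :: nat
  assumes \<alpha>: "0 < \<alpha>" and t: "0 \<le> t" "t \<le> T"
  defines "e \<equiv> \<alpha> * real j + 1"
  shows "(LINT s:{0..T}|lborel. (\<bar>t - s\<bar> powr \<alpha>) ^ j) = (t powr e + (T - t) powr e) / e"
proof -
  have e: "e > 0" unfolding e_def using \<alpha> by (simp add: add_nonneg_pos)
  have "((\<lambda>s. (\<bar>t - s\<bar> powr \<alpha>) ^ j) has_integral (- ((t - t) powr e / e) - - ((t - 0) powr e / e))) {0..t}"
  proof (rule fundamental_theorem_of_calculus_interior)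
    show "continuous_on {0..t} (\<lambda>s. - ((t - s) powr e / e))"
      using e by (intro continuous_on_minus continuous_on_divide continuous_on_powr' continuous_intros) auto
    fix s assume s: "s \<in> {0<..<t}"
    then have "((\<lambda>s. - ((t - s) powr e / e)) has_real_derivative (t - s) powr (\<alpha> * real j)) (at s)"
      using e by (auto intro!: derivative_eq_intros simp: e_def)
    then show "((\<lambda>s. - ((t - s) powr e / e)) has_vector_derivative (\<bar>t - s\<bar> powr \<alpha>) ^ j) (at s)"
      using s by (simp add: has_real_derivative_iff_has_vector_derivative powr_power_nat)
  qed (use t in auto)
  moreover have "((\<lambda>s. (\<bar>t - s\<bar> powr \<alpha>) ^ j) has_integral ((T - t) powr e / e - (t - t) powr e / e)) {t..T}"
  proof (rule fundamental_theorem_of_calculus_interior)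
    show "continuous_on {t..T} (\<lambda>s. (s - t) powr e / e)"
      using e by (intro continuous_on_divide continuous_on_powr' continuous_intros) auto
    fix s assume s: "s \<in> {t<..<T}"
    then have "((\<lambda>s. (s - t) powr e / e) has_real_derivative (s - t) powr (\<alpha> * real j)) (at s)"
      using e by (auto intro!: derivative_eq_intros simp: e_def)
    then show "((\<lambda>s. (s - t) powr e / e) has_vector_derivative (\<bar>t - s\<bar> powr \<alpha>) ^ j) (at s)"
      using s by (simp add: has_real_derivative_iff_has_vector_derivative powr_power_nat)
  qed (use t in auto)
  ultimately have "((\<lambda>s. (\<bar>t - s\<bar> powr \<alpha>) ^ j) has_integral
      (- ((t - t) powr e / e) - - ((t - 0) powr e / e)) + ((T - t) powr e / e - (t - t) powr e / e)) {0..T}"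
    by (rule has_integral_combine[OF t])
  then have "integral {0..T} (\<lambda>s. (\<bar>t - s\<bar> powr \<alpha>) ^ j) = (t powr e + (T - t) powr e) / e"
    using e by (simp add: integral_unique add_divide_distrib)
  moreover have "set_integrable lborel {0..T} (\<lambda>s. (\<bar>t - s\<bar> powr \<alpha>) ^ j)"
    by (intro borel_integrable_atLeastAtMost' continuous_on_abs_diff_powr_power \<alpha>)
  ultimately show ?thesis by (simp add: set_borel_integral_eq_integral(2))
qed

text \<open>The antiderivative \<open>F\<close> takes opposite values at the two endpoints, whence
  the factor 2 that reappears in front of the form factor series.\<close>

lemma set_integral_powr_add_reflect:
  fixes T e :: real
  assumes e: "0 < e" and T: "0 \<le> T"
  shows "(LINT t:{0..T}|lborel. t powr e + (T - t) powr e) = 2 * T powr (e + 1) / (e + 1)"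
proof -
  define F where "F = (\<lambda>t. (t powr (e + 1) - (T - t) powr (e + 1)) / (e + 1))"
  have "((\<lambda>t. t powr e + (T - t) powr e) has_integral (F T - F 0)) {0..T}"
  proof (rule fundamental_theorem_of_calculus_interior[OF T])
    show "continuous_on {0..T} F"
      unfolding F_def using e by (intro continuous_on_divide continuous_on_diff continuous_on_powr' continuous_intros) auto
    fix t assume t: "t \<in> {0<..<T}"
    then have "(F has_real_derivative (((e + 1) * t powr e + (e + 1) * (T - t) powr e)) / (e + 1)) (at t)"
      unfolding F_def using e by (auto intro!: derivative_eq_intros)
    moreover have "((e + 1) * t powr e + (e + 1) * (T - t) powr e) / (e + 1) = t powr e + (T - t) powr e"
      using e by (simp add: add_divide_distrib)
    ultimately show "(F has_vector_derivative t powr e + (T - t) powr e) (at t)"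
      by (simp add: has_real_derivative_iff_has_vector_derivative)
  qed
  moreover have "F T - F 0 = 2 * T powr (e + 1) / (e + 1)"
    using e by (simp add: F_def diff_divide_distrib)
  moreover have "set_integrable lborel {0..T} (\<lambda>t. t powr e + (T - t) powr e)"
    using e by (intro borel_integrable_atLeastAtMost' continuous_on_add continuous_on_powr' continuous_intros) auto
  ultimately show ?thesis by (simp add: set_borel_integral_eq_integral(2) integral_unique)
qed

text \<open>The extra denominator \<open>q\<close> is at least 1, so the Mittag-Leffler series
  dominates.\<close>

lemma summable_debye:
  fixes \<alpha> \<beta> z :: real
  assumes \<alpha>: "0 < \<alpha>" and \<beta>: "0 < \<beta>"
  shows "summable (\<lambda>j. 1 / (Gamma (\<beta> * real j + 1) * (\<alpha> * real j + 1) * (\<alpha> * real j + 2)) * z ^ j)"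
proof (rule summable_comparison_test'[OF summable_mittag_leffler_real[OF \<beta>, of z]])
  fix j :: nat
  have g: "Gamma (\<beta> * real j + 1) > 0" by (rule Gamma_linear_pos[OF \<beta>])
  define q where "q = (\<alpha> * real j + 1) * (\<alpha> * real j + 2)"
  have q: "1 \<le> q"
    unfolding q_def using \<alpha> mult_mono[of 1 "\<alpha> * real j + 1" 1 "\<alpha> * real j + 2"] by simp
  have "norm (1 / (Gamma (\<beta> * real j + 1) * (\<alpha> * real j + 1) * (\<alpha> * real j + 2)) * z ^ j) =
      \<bar>z\<bar> ^ j / Gamma (\<beta> * real j + 1) / q"
    using \<alpha> g by (simp add: q_def abs_mult power_abs add_nonneg_pos)
  also have "\<dots> \<le> \<bar>z\<bar> ^ j / Gamma (\<beta> * real j + 1) / 1"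
    using q g by (intro divide_left_mono) auto
  finally show "norm (1 / (Gamma (\<beta> * real j + 1) * (\<alpha> * real j + 1) * (\<alpha> * real j + 2)) * z ^ j)
      \<le> \<bar>z\<bar> ^ j / Gamma (\<beta> * real j + 1)" by simp
qed

text \<open>Integrating term by term, the inner integral contributes \<open>1 / e j\<close> and the
  outer one \<open>2 / (e j + 1)\<close>: these are the two linear factors of the Debye
  coefficients.\<close>

lemma mittag_leffler_double_integral:
  fixes \<alpha> \<beta> u T :: real
  assumes \<alpha>: "0 < \<alpha>" and \<beta>: "0 < \<beta>" and T: "0 < T"
  shows "(LINT t:{0..T}|lborel. LINT s:{0..T}|lborel. mittag_leffler \<beta> (complex_of_real (u * \<bar>t - s\<bar> powr \<alpha>))) =
    complex_of_real (T\<^sup>2 * (2 * (\<Sum>j. 1 / (Gamma (\<beta> * real j + 1) * (\<alpha> * real j + 1) * (\<alpha> * real j + 2)) * (T powr \<alpha> * u) ^ j)))"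
proof -
  define a where "a = (\<lambda>j. u ^ j / Gamma (\<beta> * real j + 1))"
  define e where "e = (\<lambda>j. \<alpha> * real j + 1)"
  have e1: "e j \<ge> 1" for j using \<alpha> by (simp add: e_def)
  have e0: "e j > 0" for j using e1[of j] by linarith
  define K where "K = (\<lambda>j. \<bar>a j\<bar> * (T powr \<alpha>) ^ j)"
  have K: "summable K"
  proof -
    have "K = (\<lambda>j. \<bar>u * T powr \<alpha>\<bar> ^ j / Gamma (\<beta> * real j + 1))"
      using Gamma_linear_pos[OF \<beta>] by (auto simp: K_def a_def fun_eq_iff abs_mult power_mult_distrib power_abs abs_of_pos)
    then show ?thesis using summable_mittag_leffler_real[OF \<beta>] by simp
  qed
  have Te: "T powr (e j) = (T powr \<alpha>) ^ j * T" for j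
    using T by (simp add: e_def powr_add powr_power_nat)
  have E: "mittag_leffler \<beta> (complex_of_real (u * x)) = complex_of_real (\<Sum>j. a j * x ^ j)" for x
    unfolding mittag_leffler_of_real[OF \<beta>] by (simp add: a_def power_mult_distrib)
  have inner: "(LINT s:{0..T}|lborel. \<Sum>j. a j * (\<bar>t - s\<bar> powr \<alpha>) ^ j) =
      (\<Sum>j. a j * ((t powr e j + (T - t) powr e j) / e j))" if t: "t \<in> {0..T}" for t
  proof -
    have "(LINT s:{0..T}|lborel. \<Sum>j. a j * (\<bar>t - s\<bar> powr \<alpha>) ^ j) =
        (\<Sum>j. LINT s:{0..T}|lborel. a j * (\<bar>t - s\<bar> powr \<alpha>) ^ j)"
    proof (rule set_integral_suminf_Icc[OF _ _ K])
      fix j s assume s: "s \<in> {0..T}"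
      have "\<bar>t - s\<bar> \<le> T" using s t by auto
      then have "(\<bar>t - s\<bar> powr \<alpha>) ^ j \<le> (T powr \<alpha>) ^ j" using \<alpha> by (intro power_mono powr_mono2) auto
      then show "\<bar>a j * (\<bar>t - s\<bar> powr \<alpha>) ^ j\<bar> \<le> K j"
        by (simp add: K_def abs_mult mult_left_mono)
    qed (intro continuous_on_mult continuous_on_const continuous_on_abs_diff_powr_power \<alpha>)
    also have "\<dots> = (\<Sum>j. a j * ((t powr e j + (T - t) powr e j) / e j))"
      using set_integral_abs_diff_powr_power[OF \<alpha>, of t T] t by (simp add: e_def)
    finally show ?thesis .
  qed
  have outer: "(LINT t:{0..T}|lborel. \<Sum>j. a j * ((t powr e j + (T - t) powr e j) / e j)) =
      (\<Sum>j. a j / e j * (2 * T powr (e j + 1) / (e j + 1)))"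
  proof -
    have "(LINT t:{0..T}|lborel. \<Sum>j. a j * ((t powr e j + (T - t) powr e j) / e j)) =
        (\<Sum>j. LINT t:{0..T}|lborel. a j * ((t powr e j + (T - t) powr e j) / e j))"
    proof (rule set_integral_suminf_Icc)
      \<comment> \<open>The majorant comes from \<open>e j \<ge> 1\<close> and
        \<open>T powr (e j) = (T powr \<alpha>) ^ j * T\<close>, each of the two powers being at
        most \<open>T powr (e j)\<close>.\<close>
      show "summable (\<lambda>j. 2 * T * K j)" by (intro summable_mult K)
      show "continuous_on {0..T} (\<lambda>t. a j * ((t powr e j + (T - t) powr e j) / e j))" for j
        using e0[of j] by (intro continuous_on_mult continuous_on_divide continuous_on_add continuous_on_powr' continuous_intros) auto
      fix j t assume t: "t \<in> {0..T}"
      have "t powr e j + (T - t) powr e j \<le> T powr e j + T powr e j"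
        using t e0[of j] by (intro add_mono powr_mono2) auto
      then have "(t powr e j + (T - t) powr e j) / e j \<le> 2 * T powr e j / 1"
        using e1[of j] by (intro frac_le) auto
      moreover have "0 \<le> (t powr e j + (T - t) powr e j) / e j" using e0[of j] by simp
      ultimately have "\<bar>a j\<bar> * \<bar>(t powr e j + (T - t) powr e j) / e j\<bar> \<le> \<bar>a j\<bar> * (2 * T powr e j)"
        by (intro mult_left_mono) auto
      then show "\<bar>a j * ((t powr e j + (T - t) powr e j) / e j)\<bar> \<le> 2 * T * K j"
        unfolding abs_mult[symmetric] by (simp add: K_def Te mult_ac)
    qed
    also have "(\<lambda>j. LINT t:{0..T}|lborel. a j * ((t powr e j + (T - t) powr e j) / e j)) =
        (\<lambda>j. a j / e j * (2 * T powr (e j + 1) / (e j + 1)))"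
    proof
      fix j
      have "(LINT t:{0..T}|lborel. a j * ((t powr e j + (T - t) powr e j) / e j)) =
          (LINT t:{0..T}|lborel. a j / e j * (t powr e j + (T - t) powr e j))"
        by (simp add: mult_ac)
      also have "\<dots> = a j / e j * (LINT t:{0..T}|lborel. t powr e j + (T - t) powr e j)"
        by (rule set_integral_mult_right)
      finally show "(LINT t:{0..T}|lborel. a j * ((t powr e j + (T - t) powr e j) / e j)) =
          a j / e j * (2 * T powr (e j + 1) / (e j + 1))"
        using T by (simp add: set_integral_powr_add_reflect[OF e0])
    qed
    finally show ?thesis .
  qed
  define c where "c = (\<lambda>j. 1 / (Gamma (\<beta> * real j + 1) * (\<alpha> * real j + 1) * (\<alpha> * real j + 2)) * (T powr \<alpha> * u) ^ j)"
  \<comment> \<open>Splitting \<open>T powr (e j + 1)\<close> as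
    \<open>(T powr \<alpha>) ^ j * T^2\<close> pulls the area of the square out of the
    series.\<close>
  have c: "a j / e j * (2 * T powr (e j + 1) / (e j + 1)) = 2 * T\<^sup>2 * c j" for j
  proof -
    have 1: "T powr (e j + 1) = (T powr \<alpha>) ^ j * T\<^sup>2" using T by (simp add: powr_add Te power2_eq_square)
    have 2: "e j + 1 = \<alpha> * real j + 2" by (simp add: e_def)
    show ?thesis unfolding 1 unfolding 2 unfolding e_def c_def a_def
      by (simp add: power_mult_distrib mult_ac)
  qed
  have "summable c" unfolding c_def by (intro summable_debye \<alpha> \<beta>)
  have "(LINT t:{0..T}|lborel. LINT s:{0..T}|lborel. mittag_leffler \<beta> (complex_of_real (u * \<bar>t - s\<bar> powr \<alpha>))) =
      complex_of_real (LINT t:{0..T}|lborel. LINT s:{0..T}|lborel. \<Sum>j. a j * (\<bar>t - s\<bar> powr \<alpha>) ^ j)"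
    unfolding E set_integral_complex_of_real ..
  also have "(LINT t:{0..T}|lborel. LINT s:{0..T}|lborel. \<Sum>j. a j * (\<bar>t - s\<bar> powr \<alpha>) ^ j) =
      (LINT t:{0..T}|lborel. \<Sum>j. a j * ((t powr e j + (T - t) powr e j) / e j))"
    by (rule set_lebesgue_integral_cong) (simp, intro allI impI inner)
  also have "\<dots> = (\<Sum>j. 2 * T\<^sup>2 * c j)" unfolding outer c ..
  also have "\<dots> = T\<^sup>2 * (2 * (\<Sum>j. c j))" using suminf_mult[OF \<open>summable c\<close>, of "2 * T\<^sup>2"] by simp
  finally show ?thesis unfolding c_def .
qed

section \<open>Characteristic function of the increments and the final formula\<close>

section \<open>The form factor\<close>

text \<open>A Mittag-Leffler function of a sum is in general not a product, so the coordinates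
  cannot be treated as independent. The whole inner product is instead made one extended
  pairing.\<close>

lemma grey_BM_increment_char:
  fixes M :: "(((real \<Rightarrow> real) \<Rightarrow> real) ^ 'd::finite) measure"
  assumes \<beta>: "0 < \<beta>" and \<alpha>: "0 < \<alpha>" "\<alpha> < 2"
    and M: "mittag_leffler_measure \<beta> M" and B: "generalized_grey_BM \<alpha> M B"
    and t: "0 \<le> t" and s: "0 \<le> s"
  shows "(LINT w|M. exp (\<i> * complex_of_real (k \<bullet> (B t w - B s w)))) =
    mittag_leffler \<beta> (complex_of_real (- ((norm k)\<^sup>2 / 2) * \<bar>t - s\<bar> powr \<alpha>))"
proof -
  have sp: "space M = tempered_vec" using M by (simp add: mittag_leffler_measure_def)
  define m where "m = (\<lambda>x. M_half_indicator \<alpha> t x - M_half_indicator \<alpha> s x)"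
  \<comment> \<open>\<open>\<epsilon> j\<close> carries the increment kernel \<open>m\<close> in
    slot \<open>j\<close>; summing these with weights \<open>k $ j\<close> gives the test vector
    \<eta>, the tensor product of \<open>k\<close> and \<open>m\<close>.\<close>
  define \<epsilon> :: "'d \<Rightarrow> (real \<Rightarrow> real) ^ 'd" where "\<epsilon> = (\<lambda>j. (\<chi> i. if i = j then m else (\<lambda>_. 0)))"
  define \<eta> :: "(real \<Rightarrow> real) ^ 'd" where "\<eta> = (\<chi> j. (\<lambda>x. k $ j * m x))"
  have "extended_pairing M (\<epsilon> j) (\<lambda>w. B t w $ j - B s w $ j)" for j
  proof -
    have "extended_pairing M (\<chi> i. if i = j then M_half_indicator \<alpha> r else (\<lambda>_. 0)) (\<lambda>w. B r w $ j)"
      if "0 \<le> r" for r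
      using B that by (simp add: generalized_grey_BM_def)
    from extended_pairing_lincomb[OF sp this[OF t] this[OF s], of 1 "-1"]
    have "extended_pairing M (vec_lincomb 1 (\<chi> i. if i = j then M_half_indicator \<alpha> t else (\<lambda>_. 0))
        (- 1) (\<chi> i. if i = j then M_half_indicator \<alpha> s else (\<lambda>_. 0))) (\<lambda>w. B t w $ j - B s w $ j)"
      by simp
    moreover have "vec_lincomb 1 (\<chi> i. if i = j then M_half_indicator \<alpha> t else (\<lambda>_. 0))
        (- 1) (\<chi> i. if i = j then M_half_indicator \<alpha> s else (\<lambda>_. 0)) = \<epsilon> j"
      by (auto simp: vec_lincomb_def \<epsilon>_def m_def vec_eq_iff fun_eq_iff)
    ultimately show ?thesis by simp
  qed
  then have "extended_pairing M (\<chi> i. (\<lambda>x. \<Sum>j\<in>UNIV. k $ j * (\<epsilon> j $ i) x))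
      (\<lambda>w. \<Sum>j\<in>UNIV. k $ j * (B t w $ j - B s w $ j))"
    by (intro extended_pairing_sum sp) auto
  moreover have "(\<chi> i. (\<lambda>x. \<Sum>j\<in>UNIV. k $ j * (\<epsilon> j $ i) x)) = \<eta>"
  proof -
    have "(\<Sum>j\<in>UNIV. k $ j * (\<epsilon> j $ i) x) = (\<Sum>j\<in>UNIV. if i = j then k $ j * m x else 0)" for i x
      by (intro sum.cong) (auto simp: \<epsilon>_def)
    then show ?thesis by (simp add: \<eta>_def)
  qed
  moreover have "(\<lambda>w. \<Sum>j\<in>UNIV. k $ j * (B t w $ j - B s w $ j)) = (\<lambda>w. k \<bullet> (B t w - B s w))"
    by (simp add: inner_vec_def)
  ultimately have "extended_pairing M \<eta> (\<lambda>w. k \<bullet> (B t w - B s w))" by simp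
  then have "(LINT w|M. exp (\<i> * complex_of_real (k \<bullet> (B t w - B s w)))) =
      mittag_leffler \<beta> (complex_of_real (- norm0_sq \<eta> / 2))"
    by (rule char_extended_pairing[OF \<beta> M])
  also have "norm0_sq \<eta> = (norm k)\<^sup>2 * \<bar>t - s\<bar> powr \<alpha>"
  proof -
    have "norm0_sq \<eta> = (\<Sum>j\<in>UNIV. (k $ j)\<^sup>2 * \<bar>t - s\<bar> powr \<alpha>)"
      by (simp add: norm0_sq_def \<eta>_def power_mult_distrib m_def M_half_indicator_increment[OF \<alpha>])
    also have "\<dots> = (norm k)\<^sup>2 * \<bar>t - s\<bar> powr \<alpha>"
      by (simp add: norm_vec_def L2_set_def sum_nonneg flip: sum_distrib_right)
    finally show ?thesis .
  qed
  finally show ?thesis by simp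
qed

text \<open>With \<open>T = real n\<close> the factor \<open>T^2\<close> of the double integral
  cancels the normalization by the square of \<open>n\<close>, which is nonzero.\<close>

lemma form_factor_grey_BM:
  fixes M :: "(((real \<Rightarrow> real) \<Rightarrow> real) ^ 'd::finite) measure"
  assumes n: "1 \<le> n" and \<beta>: "0 < \<beta>" and \<alpha>: "0 < \<alpha>" "\<alpha> < 2"
    and M: "mittag_leffler_measure \<beta> M" and B: "generalized_grey_BM \<alpha> M B"
  shows "form_factor M B n k = complex_of_real (2 * (\<Sum>j. 1 / (Gamma (\<beta> * real j + 1) *
    (\<alpha> * real j + 1) * (\<alpha> * real j + 2)) * (- (real n powr \<alpha> * (norm k)\<^sup>2 / 2)) ^ j))"
proof -
  have "(LINT t:{0..real n}|lborel. LINT s:{0..real n}|lborel.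
        LINT w|M. exp (\<i> * complex_of_real (k \<bullet> (B t w - B s w)))) =
      (LINT t:{0..real n}|lborel. LINT s:{0..real n}|lborel.
        mittag_leffler \<beta> (complex_of_real (- ((norm k)\<^sup>2 / 2) * \<bar>t - s\<bar> powr \<alpha>)))"
    by (intro set_lebesgue_integral_cong allI impI grey_BM_increment_char[OF \<beta> \<alpha> M B]) auto
  also have "\<dots> = complex_of_real ((real n)\<^sup>2 * (2 * (\<Sum>j. 1 / (Gamma (\<beta> * real j + 1) *
      (\<alpha> * real j + 1) * (\<alpha> * real j + 2)) * (real n powr \<alpha> * - ((norm k)\<^sup>2 / 2)) ^ j)))"
    using n by (intro mittag_leffler_double_integral \<alpha> \<beta>) simp
  also have "real n powr \<alpha> * - ((norm k)\<^sup>2 / 2) = - (real n powr \<alpha> * (norm k)\<^sup>2 / 2)" by simp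
  finally show ?thesis
    using n unfolding form_factor_def by simp
qed

theorem mainTheorem1:
  fixes \<alpha> \<beta> :: real and n :: nat
    and M :: "(((real \<Rightarrow> real) \<Rightarrow> real) ^ 'd::finite) measure"
    and B :: "real \<Rightarrow> ((real \<Rightarrow> real) \<Rightarrow> real) ^ 'd \<Rightarrow> real ^ 'd"
  assumes "n \<ge> 1" and "0 < \<beta>" and "\<beta> < 1" and "0 < \<alpha>" and "\<alpha> < 2"
    and "mittag_leffler_measure \<beta> M"
    and "generalized_grey_BM \<alpha> M B"
  shows "\<forall>k :: real ^ 'd.
     (let z = - (real n powr \<alpha> * (norm k)\<^sup>2 / 2);
          c = (\<lambda>j. 1 / (Gamma (\<beta> * real j + 1) * (\<alpha> * real j + 1) * (\<alpha> * real j + 2)) * z ^ j)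
      in summable (fox_wright_term (1, \<alpha>) (1, 1) (1, \<beta>) (3, \<alpha>) z) \<and>
         summable c \<and>
         form_factor M B n k = complex_of_real (2 * fox_wright22 (1, \<alpha>) (1, 1) (1, \<beta>) (3, \<alpha>) z) \<and>
         form_factor M B n k = complex_of_real (2 * (\<Sum>j. c j))) \<and>
     (\<forall>y :: real. y\<^sup>2 = real n powr \<alpha> * (norm k)\<^sup>2 / 2 \<longrightarrow>
         form_factor M B n k = complex_of_real (debye y \<beta> \<alpha>))"
proof
  fix k :: "real ^ 'd"
  define z where "z = - (real n powr \<alpha> * (norm k)\<^sup>2 / 2)"
  define c where "c = (\<lambda>j. 1 / (Gamma (\<beta> * real j + 1) * (\<alpha> * real j + 1) * (\<alpha> * real j + 2)) * z ^ j)"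
  \<comment> \<open>Equality of the terms, not merely of the sums, settles both summability claims
    and both series formulas at once.\<close>
  have fw: "fox_wright_term (1, \<alpha>) (1, 1) (1, \<beta>) (3, \<alpha>) z = c"
    using assms by (simp add: fun_eq_iff c_def fox_wright_term_eq)
  have sc: "summable c" unfolding c_def using assms by (intro summable_debye)
  have ff: "form_factor M B n k = complex_of_real (2 * (\<Sum>j. c j))"
    unfolding c_def z_def using assms by (intro form_factor_grey_BM)
  have "form_factor M B n k = complex_of_real (debye y \<beta> \<alpha>)"
    if "y\<^sup>2 = real n powr \<alpha> * (norm k)\<^sup>2 / 2" for y
    unfolding ff debye_def that by (simp add: c_def z_def)
  then show "(let z = - (real n powr \<alpha> * (norm k)\<^sup>2 / 2);
          c = (\<lambda>j. 1 / (Gamma (\<beta> * real j + 1) * (\<alpha> * real j + 1) * (\<alpha> * real j + 2)) * z ^ j)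
      in summable (fox_wright_term (1, \<alpha>) (1, 1) (1, \<beta>) (3, \<alpha>) z) \<and>
         summable c \<and>
         form_factor M B n k = complex_of_real (2 * fox_wright22 (1, \<alpha>) (1, 1) (1, \<beta>) (3, \<alpha>) z) \<and>
         form_factor M B n k = complex_of_real (2 * (\<Sum>j. c j))) \<and>
     (\<forall>y :: real. y\<^sup>2 = real n powr \<alpha> * (norm k)\<^sup>2 / 2 \<longrightarrow>
         form_factor M B n k = complex_of_real (debye y \<beta> \<alpha>))"
    unfolding Let_def z_def[symmetric] c_def[symmetric] fox_wright22_def fw
    using sc ff by (simp add: fw)
qed

end
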